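(* Consider the model $Y_i=\mathbf 1(X_i\in G)+\xi_i$, $i=1,\ldots,n$, with design (DD) or (RD). Assume that the noise terms $\xi_i$ are i.i.d. centered Gaussian random variables with variance $\sigma^2>0$. Then the minimax risk on the class $\mathcal S$ satisfies, asymptotically, $$\mathcal R_n(\mathcal S)\asymp_\sigma\frac{\ln n}{n}.$$
   Context: Designs: (DD) $X_i=i/n$, $i=1,\ldots,n$; (RD) $X_1\le\cdots\le X_n$ is the increasing reordering of $n$ i.i.d. uniform random variables on $[0,1]$. The noise is independent of the design. $\mathcal S=\{[a,b]:0\le a\le b\le1\}$. $\mathbb E_G$ is the expectation when the unknown set is $G$; $|\cdot|$ is Lebesgue measure; $\triangle$ is symmetric difference; $\mathbf 1(\cdot)$ is the indicator function. A set estimator $\hat G_n$ is a subset of $[0,1]$ constructed from the observations $(X_1,Y_1),\ldots,(X_n,Y_n)$. For a class $\mathcal C$ of Borel subsets of $\mathbb R$, $\mathcal R_n(\mathcal C)=\inf_{\hat G_n}\sup_{G\in\mathcal C}\mathbb E_G[|G\triangle\hat G_n|]$, the infimum being over all set estimators based on $n$ observations. For sequences $A_n,B_n$ and a parameter $\vartheta$, $A_n\asymp_\vartheta B_n$ means that there are positive constants $c(\vartheta),C(\vartheta)$ depending on $\vartheta$ such that $c(\vartheta)B_n\le A_n\le C(\vartheta)B_n$ for $n$ large enough. *)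

theory Defs
  imports "HOL-Probability.Probability"
begin

text \<open>
  The data \<open>(X\<^sub>1, Y\<^sub>1), \<dots>, (X\<^sub>n, Y\<^sub>n)\<close> form a point of the product space indexed by \<open>{1..n}\<close>.
\<close>

definition data_space :: "nat \<Rightarrow> (nat \<Rightarrow> real \<times> real) measure" where
  "data_space n = Pi\<^sub>M {1..n} (\<lambda>_. borel \<Otimes>\<^sub>M borel)"

definition regular_design :: "nat \<Rightarrow> (nat \<Rightarrow> real) measure" where
  "regular_design n =
     return (Pi\<^sub>M {1..n} (\<lambda>_. borel)) (\<lambda>i\<in>{1..n}. real i / real n)"

definition order_statistics :: "nat \<Rightarrow> (nat \<Rightarrow> real) \<Rightarrow> nat \<Rightarrow> real" where
  "order_statistics n u = (\<lambda>i\<in>{1..n}. sort (map u [1..<Suc n]) ! (i - 1))"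

definition random_design :: "nat \<Rightarrow> (nat \<Rightarrow> real) measure" where
  "random_design n =
     distr (Pi\<^sub>M {1..n} (\<lambda>_. uniform_measure lborel {0..1}))
       (Pi\<^sub>M {1..n} (\<lambda>_. borel)) (order_statistics n)"

text \<open>
  \<open>D\<close> is the joint law of the design points and \<open>N\<close> the law of a single noise term; taking the
  product of the design law with a power of \<open>N\<close> makes the noise i.i.d. and independent of the
  design.
\<close>

definition model_space ::
    "(nat \<Rightarrow> real) measure \<Rightarrow> real measure \<Rightarrow> nat \<Rightarrow> ((nat \<Rightarrow> real) \<times> (nat \<Rightarrow> real)) measure" where
  "model_space D N n = D \<Otimes>\<^sub>M Pi\<^sub>M {1..n} (\<lambda>_. N)"

definition observations ::
    "nat \<Rightarrow> real set \<Rightarrow> (nat \<Rightarrow> real) \<times> (nat \<Rightarrow> real) \<Rightarrow> nat \<Rightarrow> real \<times> real" where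
  "observations n G = (\<lambda>(x, \<xi>). \<lambda>i\<in>{1..n}. (x i, indicator G (x i) + \<xi> i))"

text \<open>
  The last clause is what is needed for the loss \<open>|G \<triangle> Ghat|\<close> to be a random variable. Since
  \<open>|G \<triangle> A| = |G| + |A| - 2 |G \<inter> A|\<close>, requiring it for all Borel \<open>G\<close> is, by a
  monotone class argument, the same as requiring it only for the segments of \<open>[0, 1]\<close>.
\<close>

definition set_estimator :: "nat \<Rightarrow> ((nat \<Rightarrow> real \<times> real) \<Rightarrow> real set) \<Rightarrow> bool" where
  "set_estimator n Ghat \<longleftrightarrow>
     (\<forall>d\<in>space (data_space n). Ghat d \<subseteq> {0..1} \<and> Ghat d \<in> sets lebesgue) \<and>
     (\<forall>G\<in>sets borel.
        (\<lambda>d. emeasure lebesgue (sym_diff G (Ghat d))) \<in> borel_measurable (data_space n))"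

definition risk ::
    "(nat \<Rightarrow> real) measure \<Rightarrow> real measure \<Rightarrow> nat \<Rightarrow> ((nat \<Rightarrow> real \<times> real) \<Rightarrow> real set) \<Rightarrow>
       real set \<Rightarrow> ennreal" where
  "risk D N n Ghat G =
     (\<integral>\<^sup>+ \<omega>. emeasure lebesgue (sym_diff G (Ghat (observations n G \<omega>))) \<partial>model_space D N n)"

definition minimax_risk ::
    "(nat \<Rightarrow> real) measure \<Rightarrow> real measure \<Rightarrow> nat \<Rightarrow> real set set \<Rightarrow> ennreal" where
  "minimax_risk D N n \<C> = (INF Ghat\<in>{Ghat. set_estimator n Ghat}. SUP G\<in>\<C>. risk D N n Ghat G)"

definition segments :: "real set set" where
  "segments = {{a..b} | a b. 0 \<le> a \<and> a \<le> b \<and> b \<le> 1}"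

definition gaussian_noise :: "real \<Rightarrow> real measure" where
  "gaussian_noise \<sigma> = density lborel (normal_density 0 \<sigma>)"

end

theory Submission
  imports Defs "HOL-Real_Asymp.Real_Asymp"
begin

text \<open>
  The rate \<open>ln n / n\<close> is the price of searching: a segment is visible in the noise only if it
  contains about \<open>\<sigma>\<^sup>2 ln n\<close> design points, because there are about \<open>n / ln n\<close> disjoint segments of
  that size and one of them collects an excess of that order by pure chance.

  Both designs enter only through one exponential moment bound, \<open>quasi_uniform_design\<close>: the
  expectation of a product \<open>\<Prod>i. h (X\<^sub>i)\<close> is, up to a constant factor, at most what it would be for
  \<open>n\<close> independent uniform points. For the random design the ordering is irrelevant because the
  product is symmetric (\<open>prod_order_statistics\<close>); for the regular design it suffices that a segment
  \<open>I\<close> contains \<open>n |I|\<close> grid points up to an error of \<open>1\<close>.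

  Upper bound (\<open>minimax_risk_le\<close>). Least squares over the \<open>(n + 1)\<^sup>2\<close> segments with endpoints in
  \<open>{0, 1/n, \<dots>, 1}\<close> maximises a score that is a sum of independent contributions. For two candidates
  \<open>G'\<close> and \<open>G\<^sub>0\<close>, where \<open>G\<^sub>0\<close> approximates the true set up to measure \<open>2 / n\<close>, the score difference
  is Gaussian with negative drift proportional to the number of design points in \<open>G' \<triangle> G\<^sub>0\<close>, so by
  the Chernoff bound \<open>G'\<close> beats \<open>G\<^sub>0\<close> with probability at most \<open>K exp (- q n |G' \<triangle> G\<^sub>0|)\<close>
  (\<open>nn_integral_exp_score_diff_le\<close>). A union bound over the candidates with
  \<open>|G' \<triangle> G\<^sub>0| > 3 ln n / (q n)\<close> leaves an error of order \<open>1 / n\<close>.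

  Lower bound (\<open>minimax_risk_ge\<close>). Take adjacent segments \<open>G\<^sub>1, \<dots>, G\<^sub>M\<close> of length \<open>\<delta> = c ln n / n\<close>
  and the null segment \<open>{0}\<close> as reference. If \<open>L\<^sub>k\<close> is the likelihood ratio of \<open>G\<^sub>k\<close> against the
  reference, then \<open>E[L\<^sub>k\<^sup>2] \<le> B\<close> with \<open>B\<close> of order \<open>sqrt n\<close> for a suitable \<open>c\<close>, so that
  \<open>B \<le> M\<close> for large \<open>n\<close>. To have small risk at every \<open>G\<^sub>k\<close>, an estimator must cover most of \<open>G\<^sub>k\<close> under the \<open>k\<close>-th law; transporting
  this to the reference law through \<open>L\<^sub>k \<le> L\<^sub>k\<^sup>2 / (4 B) + B\<close> and summing over \<open>k\<close>, the estimator would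
  have measure comparable to \<open>\<delta>\<close> when the unknown set is \<open>{0}\<close>, which is an error of that size.
\<close>

section \<open>Gaussian noise and its translates\<close>

text \<open>
  The density at \<open>y\<close> of the Gaussian law with mean \<open>m\<close> and variance \<open>\<sigma>\<^sup>2\<close>, relative to the
  centered one.
\<close>

definition likelihood_ratio :: "real \<Rightarrow> real \<Rightarrow> real \<Rightarrow> real" where
  "likelihood_ratio \<sigma> m y = exp ((m * y - m\<^sup>2 / 2) / \<sigma>\<^sup>2)"

lemma likelihood_ratio_measurable [measurable]: "likelihood_ratio \<sigma> m \<in> borel_measurable borel"
  unfolding likelihood_ratio_def by measurable

lemma sets_gaussian_noise [simp, measurable_cong]: "sets (gaussian_noise \<sigma>) = sets borel"
  by (simp add: gaussian_noise_def)

lemma space_gaussian_noise [simp]: "space (gaussian_noise \<sigma>) = UNIV"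
  by (simp add: gaussian_noise_def)

lemma prob_space_gaussian_noise: "\<sigma> > 0 \<Longrightarrow> prob_space (gaussian_noise \<sigma>)"
  unfolding gaussian_noise_def by (rule prob_space_normal_density)

lemma normal_density_likelihood_ratio:
  assumes "\<sigma> > 0"
  shows "normal_density 0 \<sigma> y * likelihood_ratio \<sigma> m y = normal_density m \<sigma> y"
proof -
  have "exp (- (y - 0)\<^sup>2 / (2 * \<sigma>\<^sup>2)) * exp ((m * y - m\<^sup>2 / 2) / \<sigma>\<^sup>2) = exp (- (y - m)\<^sup>2 / (2 * \<sigma>\<^sup>2))"
    unfolding exp_add [symmetric] using assms
    by (simp add: field_simps power2_eq_square)
  then show ?thesis
    by (simp add: normal_density_def likelihood_ratio_def)
qed

lemma nn_integral_likelihood_ratio: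
  assumes "\<sigma> > 0" and [measurable]: "f \<in> borel_measurable borel"
  shows "(\<integral>\<^sup>+ y. ennreal (likelihood_ratio \<sigma> m y) * f y \<partial>gaussian_noise \<sigma>) =
    (\<integral>\<^sup>+ y. f (m + y) \<partial>gaussian_noise \<sigma>)"
proof -
  have "(\<integral>\<^sup>+ y. ennreal (likelihood_ratio \<sigma> m y) * f y \<partial>gaussian_noise \<sigma>) =
      (\<integral>\<^sup>+ y. ennreal (normal_density m \<sigma> y) * f y \<partial>lborel)"
    unfolding gaussian_noise_def normal_density_likelihood_ratio [OF assms(1), of _ m, symmetric]
    by (subst nn_integral_density) (simp_all add: ennreal_mult' likelihood_ratio_def mult.assoc)
  also have "\<dots> = (\<integral>\<^sup>+ y. ennreal (normal_density 0 \<sigma> y) * f (m + y) \<partial>lborel)"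
    by (subst nn_integral_real_affine [where t = m and c = 1])
       (auto simp: normal_density_def)
  also have "\<dots> = (\<integral>\<^sup>+ y. f (m + y) \<partial>gaussian_noise \<sigma>)"
    unfolding gaussian_noise_def by (subst nn_integral_density) auto
  finally show ?thesis .
qed

lemma nn_integral_exp_gaussian_noise:
  assumes "\<sigma> > 0"
  shows "(\<integral>\<^sup>+ y. ennreal (exp (s * y)) \<partial>gaussian_noise \<sigma>) = ennreal (exp (s\<^sup>2 * \<sigma>\<^sup>2 / 2))"
proof -
  interpret prob_space "gaussian_noise \<sigma>"
    using assms by (rule prob_space_gaussian_noise)
  have eq: "ennreal (exp (s * y)) =
      ennreal (likelihood_ratio \<sigma> (s * \<sigma>\<^sup>2) y) * ennreal (exp (s\<^sup>2 * \<sigma>\<^sup>2 / 2))" for y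
    using assms
    by (simp add: likelihood_ratio_def ennreal_mult' [symmetric] exp_add [symmetric] field_simps
        power2_eq_square)
  show ?thesis
    unfolding eq using assms
    by (subst nn_integral_likelihood_ratio) (auto simp: emeasure_space_1 [simplified])
qed

text \<open>
  Cameron-Martin in finite dimension: translating the noise vector by \<open>m\<close> has the same effect as
  weighting it with the product of the one-dimensional likelihood ratios. Both the weighted law and
  the translated law are the product of the translated coordinate laws, since they agree on boxes.
\<close>

lemma nn_integral_PiM_likelihood_ratio:
  assumes "\<sigma> > 0" and I: "finite I"
    and [measurable]: "f \<in> borel_measurable (Pi\<^sub>M I (\<lambda>_. borel))"
  shows "(\<integral>\<^sup>+ y. (\<Prod>i\<in>I. ennreal (likelihood_ratio \<sigma> (m i) (y i))) * f y \<partial>Pi\<^sub>M I (\<lambda>_. gaussian_noise \<sigma>)) =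
    (\<integral>\<^sup>+ y. f (\<lambda>i\<in>I. m i + y i) \<partial>Pi\<^sub>M I (\<lambda>_. gaussian_noise \<sigma>))"
proof -
  let ?N = "gaussian_noise \<sigma>"
  let ?P = "Pi\<^sub>M I (\<lambda>_. ?N)"
  let ?L = "\<lambda>y. \<Prod>i\<in>I. ennreal (likelihood_ratio \<sigma> (m i) (y i))"
  interpret prob_space ?N
    using assms(1) by (rule prob_space_gaussian_noise)
  interpret product_sigma_finite "\<lambda>_. ?N" ..
  interpret P: prob_space ?P
    by (intro prob_space_PiM) unfold_locales
  let ?N' = "\<lambda>i. distr ?N borel (\<lambda>y. m i + y)"
  have N': "prob_space (?N' i)" for i
    by (rule prob_space_distr) simp
  interpret N': product_sigma_finite ?N'
    by (rule product_sigma_finite.intro) (auto intro: prob_space_imp_sigma_finite N')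
  have f [measurable]: "f \<in> borel_measurable ?P"
    using assms(3) by (simp cong: measurable_cong_sets sets_PiM_cong)
  have *: "emeasure (?N' i) A = (\<integral>\<^sup>+ y. ennreal (likelihood_ratio \<sigma> (m i) y) * indicator A y \<partial>?N)"
    if [measurable]: "A \<in> sets borel" for i A
  proof -
    have "emeasure (?N' i) A = (\<integral>\<^sup>+ y. indicator A y \<partial>?N' i)"
      by simp
    also have "\<dots> = (\<integral>\<^sup>+ y. indicator A (m i + y) \<partial>?N)"
      by (rule nn_integral_distr) simp_all
    finally show ?thesis
      using assms(1) by (simp add: nn_integral_likelihood_ratio)
  qed
  have "density ?P ?L = Pi\<^sub>M I ?N'"
  proof (rule N'.PiM_eqI)
    show "sets (density ?P ?L) = sets (Pi\<^sub>M I ?N')"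
      by (simp cong: sets_PiM_cong)
    fix A assume "\<And>i. i \<in> I \<Longrightarrow> A i \<in> sets (?N' i)"
    then have A [measurable]: "\<And>i. i \<in> I \<Longrightarrow> A i \<in> sets borel" by simp
    have "Pi\<^sub>E I A \<in> sets ?P"
      using A I by (intro sets_PiM_I_finite) auto
    then have "emeasure (density ?P ?L) (Pi\<^sub>E I A) = (\<integral>\<^sup>+ y. ?L y * indicator (Pi\<^sub>E I A) y \<partial>?P)"
      using I by (subst emeasure_density) auto
    also have "\<dots> = (\<integral>\<^sup>+ y. (\<Prod>i\<in>I. ennreal (likelihood_ratio \<sigma> (m i) (y i)) * indicator (A i) (y i)) \<partial>?P)"
      using I by (intro nn_integral_cong)
        (auto simp: prod.distrib indicator_def space_PiM PiE_iff extensional_def)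
    also have "\<dots> = (\<Prod>i\<in>I. emeasure (?N' i) (A i))"
      using I by (subst product_nn_integral_prod) (auto simp: * intro!: prod.cong)
    finally show "emeasure (density ?P ?L) (Pi\<^sub>E I A) = (\<Prod>i\<in>I. emeasure (?N' i) (A i))" .
  qed (use I in auto)
  moreover have "distr ?P (Pi\<^sub>M I (\<lambda>_. borel)) (\<lambda>y. \<lambda>i\<in>I. m i + y i) = Pi\<^sub>M I ?N'"
  proof (rule N'.PiM_eqI)
    show "sets (distr ?P (Pi\<^sub>M I (\<lambda>_. borel)) (\<lambda>y. \<lambda>i\<in>I. m i + y i)) = sets (Pi\<^sub>M I ?N')"
      by (simp cong: sets_PiM_cong)
    fix A assume "\<And>i. i \<in> I \<Longrightarrow> A i \<in> sets (?N' i)"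
    then have A [measurable]: "\<And>i. i \<in> I \<Longrightarrow> A i \<in> sets borel" by simp
    have "Pi\<^sub>E I A \<in> sets (Pi\<^sub>M I (\<lambda>_. borel))"
      using A I by (intro sets_PiM_I_finite) auto
    then have "emeasure (distr ?P (Pi\<^sub>M I (\<lambda>_. borel)) (\<lambda>y. \<lambda>i\<in>I. m i + y i)) (Pi\<^sub>E I A) =
        emeasure ?P ((\<lambda>y. \<lambda>i\<in>I. m i + y i) -` Pi\<^sub>E I A \<inter> space ?P)"
      by (subst emeasure_distr) auto
    also have "(\<lambda>y. \<lambda>i\<in>I. m i + y i) -` Pi\<^sub>E I A \<inter> space ?P = Pi\<^sub>E I (\<lambda>i. (\<lambda>y. m i + y) -` A i)"
      by (auto simp: space_PiM PiE_iff extensional_def)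
    also have "emeasure ?P \<dots> = (\<Prod>i\<in>I. emeasure (?N' i) (A i))"
    proof -
      have "(\<lambda>y. m i + y) -` A i \<in> sets borel" if "i \<in> I" for i
        using A [OF that] by (intro measurable_sets_borel [of _ borel]) simp_all
      then show ?thesis
        using I A by (subst emeasure_PiM) (auto simp: emeasure_distr intro!: prod.cong)
    qed
    finally show "emeasure (distr ?P (Pi\<^sub>M I (\<lambda>_. borel)) (\<lambda>y. \<lambda>i\<in>I. m i + y i)) (Pi\<^sub>E I A) =
        (\<Prod>i\<in>I. emeasure (?N' i) (A i))" .
  qed (use I in auto)
  ultimately have eq: "density ?P ?L = distr ?P (Pi\<^sub>M I (\<lambda>_. borel)) (\<lambda>y. \<lambda>i\<in>I. m i + y i)"
    by simp
  have "(\<integral>\<^sup>+ y. ?L y * f y \<partial>?P) = (\<integral>\<^sup>+ y. f y \<partial>density ?P ?L)"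
    using I by (subst nn_integral_density) auto
  also have "\<dots> = (\<integral>\<^sup>+ y. f (\<lambda>i\<in>I. m i + y i) \<partial>?P)"
    unfolding eq by (subst nn_integral_distr) auto
  finally show ?thesis .
qed

section \<open>Designs that behave like the uniform distribution\<close>

text \<open>
  For independent uniform points the expectation of \<open>\<Prod>i. h (X\<^sub>i)\<close> is the \<open>n\<close>-th power of the integral
  of \<open>h\<close>, and \<open>1 + z \<le> exp z\<close> turns a step-function majorant of \<open>h\<close> into the exponential of its
  integral. The additional term \<open>\<Sum>j. \<bar>v j\<bar>\<close> leaves room for the discretisation error of
  deterministic points. Majorants with coefficients of both signs are needed: negative ones express
  that \<open>h\<close> is small on a set that contains many design points. An interval with \<open>a j > b j\<close> is
  empty and contributes nothing.
\<close>

definition quasi_uniform_design :: "nat \<Rightarrow> (nat \<Rightarrow> real) measure \<Rightarrow> bool" where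
  "quasi_uniform_design n D \<longleftrightarrow>
     prob_space D \<and> sets D = sets (Pi\<^sub>M {1..n} (\<lambda>_. borel)) \<and>
     (\<forall>(J :: nat set) v a b h.
        finite J \<longrightarrow> (\<forall>j\<in>J. 0 \<le> a j \<and> b j \<le> 1) \<longrightarrow> h \<in> borel_measurable borel \<longrightarrow>
        (\<forall>x\<in>{0..1}. 0 \<le> h x \<and> h x \<le> 1 + (\<Sum>j\<in>J. v j * indicator {a j..b j} x)) \<longrightarrow>
        (\<integral>\<^sup>+ x. (\<Prod>i\<in>{1..n}. ennreal (h (x i))) \<partial>D) \<le>
          ennreal (exp (real n * (\<Sum>j\<in>J. v j * measure lborel {a j..b j}) + (\<Sum>j\<in>J. \<bar>v j\<bar>))))"

text \<open>
  The grid starts at \<open>1 / n\<close> and not at \<open>0\<close>, so the case \<open>a = 0\<close> loses one point compared to the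
  formula \<open>\<lfloor>n b\<rfloor> - \<lceil>n a\<rceil> + 1\<close>; the error stays at most \<open>1\<close>.
\<close>

lemma card_grid_points_in_interval:
  assumes "n \<ge> 1" "0 \<le> a" "b \<le> 1"
  shows "\<bar>(\<Sum>i\<in>{1..n}. indicator {a..b} (real i / real n)) - real n * measure lborel {a..b}\<bar> \<le> 1"
proof (cases "a \<le> b")
  case True
  define k where "k = max 1 (nat \<lceil>real n * a\<rceil>)"
  define l where "l = nat \<lfloor>real n * b\<rfloor>"
  have nb: "real n * b \<le> real n" and ab: "real n * a \<le> real n * b" and na: "real n * a \<ge> 0"
    using assms True by (auto intro: mult_left_mono mult_left_le)
  have "{i\<in>{1..n}. real i / real n \<in> {a..b}} = {k..l}"
  proof (intro set_eqI)
    fix i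
    have "i \<in> {i\<in>{1..n}. real i / real n \<in> {a..b}} \<longleftrightarrow> 1 \<le> i \<and> i \<le> n \<and> real n * a \<le> i \<and> i \<le> real n * b"
      using assms by (auto simp: field_simps)
    also have "\<dots> \<longleftrightarrow> 1 \<le> i \<and> real n * a \<le> i \<and> i \<le> real n * b"
      using nb by auto
    also have "\<dots> \<longleftrightarrow> i \<in> {k..l}"
      unfolding k_def l_def using na ab by (auto simp: le_nat_floor) linarith+
    finally show "i \<in> {i\<in>{1..n}. real i / real n \<in> {a..b}} \<longleftrightarrow> i \<in> {k..l}" .
  qed
  then have "(\<Sum>i\<in>{1..n}. indicator {a..b} (real i / real n) :: real) = real (Suc l - k)"
    by (simp add: indicator_def sum.If_cases Int_def)
  moreover have "\<bar>real (Suc l - k) - (real n * b - real n * a)\<bar> \<le> 1"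
  proof (cases "a = 0")
    case True
    then show ?thesis
      unfolding k_def l_def using na ab by simp linarith
  next
    case False
    with assms have "real n * a > 0" by simp
    then have "k = nat \<lceil>real n * a\<rceil>"
      unfolding k_def by linarith
    then show ?thesis
      unfolding l_def using na ab by simp linarith
  qed
  ultimately show ?thesis
    using True by (simp add: algebra_simps)
qed simp

lemma quasi_uniform_regular_design:
  assumes "n \<ge> 1"
  shows "quasi_uniform_design n (regular_design n)"
  unfolding quasi_uniform_design_def
proof (intro conjI allI impI)
  have sp: "(\<lambda>i\<in>{1..n}. real i / real n) \<in> space (Pi\<^sub>M {1..n} (\<lambda>_. borel))"
    by (simp add: space_PiM)
  show "prob_space (regular_design n)"
    unfolding regular_design_def using sp by (rule prob_space_return)
  show "sets (regular_design n) = sets (Pi\<^sub>M {1..n} (\<lambda>_. borel))"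
    by (simp add: regular_design_def)
  fix J :: "nat set" and v a b :: "nat \<Rightarrow> real" and h :: "real \<Rightarrow> real"
  assume J: "finite J" and ab: "\<forall>j\<in>J. 0 \<le> a j \<and> b j \<le> 1"
    and [measurable]: "h \<in> borel_measurable borel"
    and h: "\<forall>x\<in>{0..1}. 0 \<le> h x \<and> h x \<le> 1 + (\<Sum>j\<in>J. v j * indicator {a j..b j} x)"
  have h': "0 \<le> h (real i / real n) \<and>
      h (real i / real n) \<le> exp (\<Sum>j\<in>J. v j * indicator {a j..b j} (real i / real n))" if "i \<in> {1..n}" for i
  proof -
    have "real i / real n \<in> {0..1}"
      using that by auto
    then show ?thesis
      using h exp_ge_add_one_self [of "\<Sum>j\<in>J. v j * indicator {a j..b j} (real i / real n)"]
      by (meson order_trans)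
  qed
  have "(\<integral>\<^sup>+ x. (\<Prod>i\<in>{1..n}. ennreal (h (x i))) \<partial>regular_design n) =
      (\<Prod>i\<in>{1..n}. ennreal (h (real i / real n)))"
    unfolding regular_design_def using sp
    by (subst nn_integral_return) (auto intro!: prod.cong)
  also have "\<dots> = ennreal (\<Prod>i\<in>{1..n}. h (real i / real n))"
    using h' by (subst prod_ennreal) auto
  also have "(\<Prod>i\<in>{1..n}. h (real i / real n)) \<le>
      (\<Prod>i\<in>{1..n}. exp (\<Sum>j\<in>J. v j * indicator {a j..b j} (real i / real n)))"
    using h' by (intro prod_mono) auto
  also have "\<dots> = exp (\<Sum>j\<in>J. v j * (\<Sum>i\<in>{1..n}. indicator {a j..b j} (real i / real n)))"
    by (simp add: exp_sum sum_distrib_left sum.swap [of _ J] flip: exp_sum)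
  also have "\<dots> \<le> exp (\<Sum>j\<in>J. v j * (real n * measure lborel {a j..b j}) + \<bar>v j\<bar>)"
    unfolding exp_le_cancel_iff
  proof (intro sum_mono)
    fix j assume "j \<in> J"
    define c where "c = (\<Sum>i\<in>{1..n}. indicator {a j..b j} (real i / real n)) - real n * measure lborel {a j..b j}"
    have "\<bar>c\<bar> \<le> 1"
      unfolding c_def using \<open>j \<in> J\<close> ab assms by (intro card_grid_points_in_interval) auto
    then have "\<bar>v j * c\<bar> \<le> \<bar>v j\<bar>"
      by (simp add: abs_mult mult_left_le)
    then show "v j * (\<Sum>i\<in>{1..n}. indicator {a j..b j} (real i / real n)) \<le>
        v j * (real n * measure lborel {a j..b j}) + \<bar>v j\<bar>"
      unfolding c_def right_diff_distrib by linarith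
  qed
  also have "(\<Sum>j\<in>J. v j * (real n * measure lborel {a j..b j}) + \<bar>v j\<bar>) =
      real n * (\<Sum>j\<in>J. v j * measure lborel {a j..b j}) + (\<Sum>j\<in>J. \<bar>v j\<bar>)"
    by (simp add: sum.distrib sum_distrib_left mult.left_commute)
  finally show "(\<integral>\<^sup>+ x. (\<Prod>i\<in>{1..n}. ennreal (h (x i))) \<partial>regular_design n) \<le>
      ennreal (exp (real n * (\<Sum>j\<in>J. v j * measure lborel {a j..b j}) + (\<Sum>j\<in>J. \<bar>v j\<bar>)))"
    by (simp add: ennreal_leI)
qed

text \<open>
  Expresses an order statistic through a counting function, which makes its measurability evident.
\<close>

lemma sorted_nth_le_iff_length_filter:
  fixes t :: "'a :: linorder"
  assumes "sorted xs" "k < length xs"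
  shows "xs ! k \<le> t \<longleftrightarrow> k < length (filter (\<lambda>x. x \<le> t) xs)"
  using assms
proof (induction xs arbitrary: k)
  case (Cons x xs)
  show ?case
  proof (cases "x \<le> t")
    case True
    with Cons show ?thesis by (cases k) auto
  next
    case False
    with Cons.prems have "\<forall>y\<in>set (x # xs). \<not> y \<le> t" by auto
    moreover have "(x # xs) ! k \<in> set (x # xs)"
      using Cons.prems(2) by (rule nth_mem)
    ultimately show ?thesis
      by (auto simp: filter_empty_conv)
  qed
qed simp

lemma measurable_order_statistics [measurable]:
  "order_statistics n \<in> Pi\<^sub>M {1..n} (\<lambda>_. borel) \<rightarrow>\<^sub>M Pi\<^sub>M {1..n} (\<lambda>_. borel)"
  unfolding order_statistics_def
proof (intro measurable_restrict borel_measurable_iff_le [THEN iffD2] allI)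
  fix i t assume i: "i \<in> {1..n}"
  let ?B = "Pi\<^sub>M {1..n} (\<lambda>_. borel :: real measure)"
  have "sort (map u [1..<Suc n]) ! (i - 1) \<le> t \<longleftrightarrow> real i \<le> (\<Sum>j\<in>{1..n}. indicator {..t} (u j))" for u :: "nat \<Rightarrow> real"
  proof -
    have "sort (map u [1..<Suc n]) ! (i - 1) \<le> t \<longleftrightarrow>
        i - 1 < length (filter (\<lambda>x. x \<le> t) (sort (map u [1..<Suc n])))"
      using i by (intro sorted_nth_le_iff_length_filter) (auto simp del: upt_Suc)
    also have "length (filter (\<lambda>x. x \<le> t) (sort (map u [1..<Suc n]))) = card {j\<in>{1..n}. u j \<le> t}"
    proof -
      have "length (filter (\<lambda>x. x \<le> t) (sort (map u [1..<Suc n]))) =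
          length (filter (\<lambda>j. u j \<le> t) [1..<Suc n])"
        by (simp add: filter_sort filter_map o_def del: upt_Suc)
      also have "\<dots> = card (set (filter (\<lambda>j. u j \<le> t) [1..<Suc n]))"
        by (subst distinct_card) (auto simp del: upt_Suc)
      also have "set (filter (\<lambda>j. u j \<le> t) [1..<Suc n]) = {j\<in>{1..n}. u j \<le> t}"
        by auto
      finally show ?thesis .
    qed
    also have "i - 1 < card {j\<in>{1..n}. u j \<le> t} \<longleftrightarrow> i \<le> card {j\<in>{1..n}. u j \<le> t}"
      using i by auto
    also have "\<dots> \<longleftrightarrow> real i \<le> (\<Sum>j\<in>{1..n}. indicator {..t} (u j))"
      by (simp add: indicator_def sum.If_cases Int_def)
    finally show ?thesis .
  qed
  moreover have "{u \<in> space ?B. real i \<le> (\<Sum>j\<in>{1..n}. indicator {..t} (u j))} \<in> sets ?B"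
    by measurable
  ultimately show "{u \<in> space ?B. sort (map u [1..<Suc n]) ! (i - 1) \<le> t} \<in> sets ?B"
    by simp
qed

lemma prod_order_statistics:
  fixes f :: "real \<Rightarrow> 'a :: comm_monoid_mult"
  shows "(\<Prod>i\<in>{1..n}. f (order_statistics n u i)) = (\<Prod>i\<in>{1..n}. f (u i))"
proof -
  let ?xs = "map u [1..<Suc n]"
  have len: "length (sort ?xs) = n" by simp
  have "(\<Prod>i\<in>{1..n}. f (order_statistics n u i)) = (\<Prod>i\<in>{1..n}. f (sort ?xs ! (i - 1)))"
    by (intro prod.cong) (auto simp: order_statistics_def)
  also have "\<dots> = (\<Prod>i<n. f (sort ?xs ! i))"
    by (rule prod.reindex_bij_witness [of _ Suc "\<lambda>i. i - 1"]) auto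
  also have "\<dots> = prod_list (map f (sort ?xs))"
    using len by (simp only: prod.list_conv_set_nth length_map atLeast0LessThan) (auto intro!: prod.cong)
  also have "\<dots> = prod_mset (image_mset f (mset (sort ?xs)))"
    by (metis mset_map prod_mset_prod_list)
  also have "\<dots> = prod_mset (image_mset f (mset ?xs))"
    by simp
  also have "\<dots> = prod_list (map f ?xs)"
    by (metis mset_map prod_mset_prod_list)
  also have "\<dots> = (\<Prod>i\<in>{1..n}. f (u i))"
    by (simp add: prod.distinct_set_conv_list [symmetric] o_def atLeastLessThanSuc_atLeastAtMost del: upt_Suc)
  finally show ?thesis .
qed

lemma quasi_uniform_random_design: "quasi_uniform_design n (random_design n)"
  unfolding quasi_uniform_design_def
proof (intro conjI allI impI)
  let ?U = "uniform_measure lborel {0..1 :: real}"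
  interpret U: prob_space ?U
    by (rule prob_space_uniform_measure) auto
  interpret P: product_sigma_finite "\<lambda>_. ?U" ..
  let ?P = "Pi\<^sub>M {1..n} (\<lambda>_. ?U)"
  interpret PP: prob_space ?P
    by (intro prob_space_PiM) unfold_locales
  have sets_P: "sets ?P = sets (Pi\<^sub>M {1..n} (\<lambda>_. borel))"
    by (intro sets_PiM_cong) auto
  have meas [measurable]: "order_statistics n \<in> ?P \<rightarrow>\<^sub>M Pi\<^sub>M {1..n} (\<lambda>_. borel)"
    using measurable_order_statistics by (simp cong: measurable_cong_sets add: sets_P)
  show "prob_space (random_design n)"
    unfolding random_design_def by (rule PP.prob_space_distr) (rule meas)
  show "sets (random_design n) = sets (Pi\<^sub>M {1..n} (\<lambda>_. borel))"
    by (simp add: random_design_def)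
  fix J :: "nat set" and v a b :: "nat \<Rightarrow> real" and h :: "real \<Rightarrow> real"
  assume J: "finite J" and ab: "\<forall>j\<in>J. 0 \<le> a j \<and> b j \<le> 1"
    and [measurable]: "h \<in> borel_measurable borel"
    and h: "\<forall>x\<in>{0..1}. 0 \<le> h x \<and> h x \<le> 1 + (\<Sum>j\<in>J. v j * indicator {a j..b j} x)"
  let ?s = "\<Sum>j\<in>J. v j * measure lborel {a j..b j}"
  have in_unit: "AE x in ?U. x \<in> {0..1}"
    by (subst AE_uniform_measure) auto
  let ?g = "\<lambda>x. 1 + (\<Sum>j\<in>J. v j * indicator {a j..b j} x) :: real"
  have AE_h: "AE x in ?U. 0 \<le> h x \<and> h x \<le> ?g x"
    using in_unit by (rule eventually_mono) (use h in blast)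
  have "(\<integral>\<^sup>+ x. ennreal (h x) \<partial>?U) \<le> (\<integral>\<^sup>+ x. ennreal (?g x) \<partial>?U)"
    by (intro nn_integral_mono_AE, rule eventually_mono [OF AE_h]) (simp add: ennreal_leI)
  also have "\<dots> = ennreal (\<integral> x. ?g x \<partial>?U)"
  proof (rule nn_integral_eq_integral)
    show "integrable ?U ?g"
      by (intro Bochner_Integration.integrable_add Bochner_Integration.integrable_sum
          integrable_mult_right U.integrable_const integrable_real_indicator) (auto simp: U.emeasure_eq_measure)
    show "AE x in ?U. 0 \<le> ?g x"
      using AE_h by (rule eventually_mono) linarith
  qed
  also have "(\<integral> x. ?g x \<partial>?U) = 1 + ?s"
  proof -
    have "measure ?U {a j..b j} = measure lborel {a j..b j}" if "j \<in> J" for j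
    proof -
      have "{0..1} \<inter> {a j..b j} = {a j..b j}"
        using ab that by auto
      then show ?thesis
        by (subst measure_uniform_measure) auto
    qed
    then show ?thesis
      by (subst Bochner_Integration.integral_add)
        (auto simp: U.prob_space U.emeasure_eq_measure Bochner_Integration.integral_sum intro!: sum.cong Bochner_Integration.integrable_sum)
  qed
  finally have le: "(\<integral>\<^sup>+ x. ennreal (h x) \<partial>?U) \<le> ennreal (exp ?s)"
    using exp_ge_add_one_self [of ?s] by (meson ennreal_leI order_trans)
  have "(\<integral>\<^sup>+ x. (\<Prod>i\<in>{1..n}. ennreal (h (x i))) \<partial>random_design n) =
      (\<integral>\<^sup>+ u. (\<Prod>i\<in>{1..n}. ennreal (h (u i))) \<partial>?P)"
    unfolding random_design_def
    by (subst nn_integral_distr [OF meas], measurable)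
       (simp only: prod_order_statistics [of "\<lambda>x. ennreal (h x)"])
  also have "\<dots> = (\<integral>\<^sup>+ x. ennreal (h x) \<partial>?U) ^ n"
    by (subst P.product_nn_integral_prod) auto
  also have "\<dots> \<le> ennreal (exp ?s) ^ n"
    using le by (rule power_mono) simp
  also have "\<dots> = ennreal (exp (real n * ?s))"
    by (simp add: ennreal_power exp_of_nat_mult)
  also have "\<dots> \<le> ennreal (exp (real n * ?s + (\<Sum>j\<in>J. \<bar>v j\<bar>)))"
    by (intro ennreal_leI) (simp add: sum_nonneg)
  finally show "(\<integral>\<^sup>+ x. (\<Prod>i\<in>{1..n}. ennreal (h (x i))) \<partial>random_design n) \<le>
      ennreal (exp (real n * ?s + (\<Sum>j\<in>J. \<bar>v j\<bar>)))" .
qed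

section \<open>Integration over the model space\<close>

lemma quasi_uniform_designD:
  assumes "quasi_uniform_design n D"
  shows "prob_space D" and "sets D = sets (Pi\<^sub>M {1..n} (\<lambda>_. borel))"
  using assms by (auto simp: quasi_uniform_design_def)

lemma sets_model_space:
  assumes "sets D = sets (Pi\<^sub>M {1..n} (\<lambda>_. borel))"
  shows "sets (model_space D (gaussian_noise \<sigma>) n) =
    sets (Pi\<^sub>M {1..n} (\<lambda>_. borel) \<Otimes>\<^sub>M Pi\<^sub>M {1..n} (\<lambda>_. borel))"
  unfolding model_space_def using assms by (intro sets_pair_measure_cong sets_PiM_cong) auto

lemma measurable_observations:
  assumes "sets D = sets (Pi\<^sub>M {1..n} (\<lambda>_. borel))" and [measurable]: "G \<in> sets borel"
  shows "observations n G \<in> model_space D (gaussian_noise \<sigma>) n \<rightarrow>\<^sub>M data_space n"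
  unfolding measurable_cong_sets [OF sets_model_space [OF assms(1)] refl] observations_def
    data_space_def split_beta'
  by measurable

lemma prob_space_model_space:
  assumes "prob_space D" "\<sigma> > 0"
  shows "prob_space (model_space D (gaussian_noise \<sigma>) n)"
proof -
  interpret D: prob_space D by fact
  interpret NP: prob_space "Pi\<^sub>M {1..n} (\<lambda>_. gaussian_noise \<sigma>)"
    using assms(2) by (intro prob_space_PiM prob_space_gaussian_noise)
  interpret pair_prob_space D "Pi\<^sub>M {1..n} (\<lambda>_. gaussian_noise \<sigma>)" ..
  show ?thesis
    unfolding model_space_def by (rule P.prob_space_axioms)
qed

lemma nn_integral_model_space:
  assumes "\<sigma> > 0" and "f \<in> borel_measurable (model_space D (gaussian_noise \<sigma>) n)"
  shows "(\<integral>\<^sup>+ \<omega>. f \<omega> \<partial>model_space D (gaussian_noise \<sigma>) n) =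
    (\<integral>\<^sup>+ x. \<integral>\<^sup>+ \<xi>. f (x, \<xi>) \<partial>Pi\<^sub>M {1..n} (\<lambda>_. gaussian_noise \<sigma>) \<partial>D)"
proof -
  interpret prob_space "Pi\<^sub>M {1..n} (\<lambda>_. gaussian_noise \<sigma>)"
    using assms(1) by (intro prob_space_PiM prob_space_gaussian_noise)
  show ?thesis
    using nn_integral_fst assms(2) unfolding model_space_def by metis
qed

text \<open>
  The way in which the design bound is used: integrating out the independent noise first turns a
  product over observations into a product \<open>\<Prod>i. h (X\<^sub>i)\<close> that depends on the design alone.
\<close>

lemma nn_integral_model_space_prod_le:
  fixes J :: "nat set" and v a b h :: "_ \<Rightarrow> real" and g :: "real \<Rightarrow> real \<Rightarrow> ennreal"
  assumes "quasi_uniform_design n D" and "\<sigma> > 0"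
    and g [measurable]: "(\<lambda>(x, y). g x y) \<in> borel_measurable (borel \<Otimes>\<^sub>M borel)"
    and h: "\<And>x. (\<integral>\<^sup>+ y. g x y \<partial>gaussian_noise \<sigma>) = ennreal (h x)"
    and [measurable]: "h \<in> borel_measurable borel"
    and J: "finite J" "\<And>j. j \<in> J \<Longrightarrow> 0 \<le> a j \<and> b j \<le> 1"
    and h_le: "\<And>x. x \<in> {0..1} \<Longrightarrow> 0 \<le> h x \<and> h x \<le> 1 + (\<Sum>j\<in>J. v j * indicator {a j..b j} x)"
  shows "(\<integral>\<^sup>+ \<omega>. (\<Prod>i\<in>{1..n}. g (fst \<omega> i) (snd \<omega> i)) \<partial>model_space D (gaussian_noise \<sigma>) n) \<le>
    ennreal (exp (real n * (\<Sum>j\<in>J. v j * measure lborel {a j..b j}) + (\<Sum>j\<in>J. \<bar>v j\<bar>)))"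
proof -
  let ?N = "gaussian_noise \<sigma>"
  interpret prob_space ?N
    using assms(2) by (rule prob_space_gaussian_noise)
  interpret product_sigma_finite "\<lambda>_. ?N" ..
  note D = quasi_uniform_designD [OF assms(1)]
  have gx [measurable]: "g x \<in> borel_measurable borel" for x
    using measurable_compose [OF measurable_Pair1' g, of x] by simp
  have "(\<lambda>\<omega>. \<Prod>i\<in>{1..n}. g (fst \<omega> i) (snd \<omega> i)) \<in> borel_measurable (model_space D ?N n)"
    unfolding measurable_cong_sets [OF sets_model_space [OF D(2)] refl] by measurable
  then have "(\<integral>\<^sup>+ \<omega>. (\<Prod>i\<in>{1..n}. g (fst \<omega> i) (snd \<omega> i)) \<partial>model_space D ?N n) =
      (\<integral>\<^sup>+ x. \<integral>\<^sup>+ \<xi>. (\<Prod>i\<in>{1..n}. g (x i) (\<xi> i)) \<partial>Pi\<^sub>M {1..n} (\<lambda>_. ?N) \<partial>D)"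
    by (subst nn_integral_model_space [OF assms(2)]) simp_all
  also have "\<dots> = (\<integral>\<^sup>+ x. (\<Prod>i\<in>{1..n}. ennreal (h (x i))) \<partial>D)"
    by (subst product_nn_integral_prod) (simp_all add: h)
  also have "\<dots> \<le> ennreal (exp (real n * (\<Sum>j\<in>J. v j * measure lborel {a j..b j}) + (\<Sum>j\<in>J. \<bar>v j\<bar>)))"
    using assms(1) J h_le unfolding quasi_uniform_design_def by simp
  finally show ?thesis .
qed

section \<open>The least-squares estimator and the upper bound\<close>

text \<open>
  Up to a term that does not depend on \<open>G\<close>, this is the negative residual sum of squares of the
  fit \<open>1\<^sub>G\<close>, because \<open>(y - 1)\<^sup>2 = y\<^sup>2 - (2 y - 1)\<close>.
\<close>

definition score :: "nat \<Rightarrow> real set \<Rightarrow> (nat \<Rightarrow> real \<times> real) \<Rightarrow> real" where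
  "score n G d = (\<Sum>i\<in>{1..n}. indicator G (fst (d i)) * (2 * snd (d i) - 1))"

lemma measurable_score [measurable]:
  assumes [measurable]: "G \<in> sets borel"
  shows "score n G \<in> borel_measurable (data_space n)"
  unfolding score_def data_space_def by measurable

lemma measure_interval_sym_diff:
  fixes a b a' b' :: real
  shows "measure lborel (sym_diff {a'..b'} {a..b}) =
    measure lborel {a'..b'} + measure lborel {a..b} - 2 * measure lborel {max a' a..min b' b}"
proof -
  have int: "integrable lborel (indicator {u..v} :: real \<Rightarrow> real)" for u v :: real
    by (intro integrable_real_indicator) (auto simp: emeasure_lborel_Icc_eq)
  have "measure lborel (sym_diff {a'..b'} {a..b}) = (\<integral> x. indicator (sym_diff {a'..b'} {a..b}) x \<partial>lborel)"
    by simp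
  also have "\<dots> = (\<integral> x. indicator {a'..b'} x + indicator {a..b} x - 2 * indicator {max a' a..min b' b} x \<partial>lborel)"
  proof (rule Bochner_Integration.integral_cong [OF refl])
    fix x
    have "x \<in> {max a' a..min b' b} \<longleftrightarrow> x \<in> {a'..b'} \<and> x \<in> {a..b}"
      by auto
    then show "indicator (sym_diff {a'..b'} {a..b}) x =
        (indicator {a'..b'} x + indicator {a..b} x - 2 * indicator {max a' a..min b' b} x :: real)"
      unfolding indicator_def by (simp del: atLeastAtMost_iff)
  qed
  also have "\<dots> = measure lborel {a'..b'} + measure lborel {a..b} - 2 * measure lborel {max a' a..min b' b}"
    using int by (simp del: measure_lborel_Icc)
  finally show ?thesis .
qed

text \<open>
  The exponential moment at \<open>1 / (4 \<sigma>\<^sup>2)\<close>, the optimal Chernoff parameter. With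
  \<open>\<kappa> = 1 / (8 \<sigma>\<^sup>2)\<close>, a design point in \<open>G' \<triangle> G\<^sub>0\<close> contributes the factor
  \<open>exp (- \<kappa>)\<close>: drift \<open>- 2 \<kappa>\<close> plus the Gaussian moment \<open>\<kappa>\<close>. The exception is a point of \<open>G' - G\<^sub>0\<close>
  that lies in the true set \<open>{a..b}\<close>, where the drift has the opposite sign and the factor is
  \<open>exp (3 \<kappa>)\<close>; these points are few when \<open>G\<^sub>0\<close> is close to the true set.
\<close>

lemma nn_integral_exp_score_diff_le:
  fixes a b a\<^sub>0 b\<^sub>0 a' b' \<sigma> :: real
  assumes D: "quasi_uniform_design n D" and \<sigma>: "\<sigma> > 0"
    and sub: "{a\<^sub>0..b\<^sub>0} \<subseteq> {a..b}"
    and "0 \<le> a" "b \<le> 1" "0 \<le> a\<^sub>0" "b\<^sub>0 \<le> 1" "0 \<le> a'" "b' \<le> 1"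
  shows "(\<integral>\<^sup>+ \<omega>. ennreal (exp ((score n {a'..b'} (observations n {a..b} \<omega>) -
              score n {a\<^sub>0..b\<^sub>0} (observations n {a..b} \<omega>)) / (4 * \<sigma>\<^sup>2))) \<partial>model_space D (gaussian_noise \<sigma>) n) \<le>
    ennreal (exp (real n * (exp (1 / (2 * \<sigma>\<^sup>2)) * (measure lborel {a..b} - measure lborel {a\<^sub>0..b\<^sub>0})
        - (1 - exp (- 1 / (8 * \<sigma>\<^sup>2))) * measure lborel (sym_diff {a'..b'} {a\<^sub>0..b\<^sub>0}))
      + (4 + 2 * exp (1 / (2 * \<sigma>\<^sup>2)))))"
proof -
  define \<kappa> where "\<kappa> = 1 / (8 * \<sigma>\<^sup>2)"
  define q where "q = 1 - exp (- \<kappa>)"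
  define C where "C = exp (4 * \<kappa>)"
  have \<kappa>: "\<kappa> > 0" and q: "0 \<le> q" "q \<le> 1" and C: "C > 0"
    using \<sigma> by (auto simp: \<kappa>_def q_def C_def)
  define f where "f x = (indicator {a'..b'} x - indicator {a\<^sub>0..b\<^sub>0} x :: real)" for x :: real
  define s where "s x = (2 * indicator {a..b} x - 1 :: real)" for x :: real
  define g where "g x y = ennreal (exp (2 * \<kappa> * f x * (s x + 2 * y)))" for x y
  define h where "h x = exp (2 * \<kappa> * f x * s x + \<kappa> * (f x)\<^sup>2)" for x
  have [measurable]: "f \<in> borel_measurable borel" "s \<in> borel_measurable borel"
    unfolding f_def s_def by measurable
  \<comment> \<open>coefficients of \<open>1 - q 1\<^sub>P + C 1\<^sub>Q\<close> with \<open>P = G' \<triangle> G\<^sub>0\<close> and \<open>Q = {a..b} - G\<^sub>0\<close>, after writing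
      \<open>1\<^sub>P\<close> and \<open>1\<^sub>Q\<close> as combinations of indicators of closed intervals\<close>
  let ?v = "\<lambda>j. [- q, - q - C, 2 * q, C] ! j"
  let ?a = "\<lambda>j. [a', a\<^sub>0, max a' a\<^sub>0, a] ! j"
  let ?b = "\<lambda>j. [b', b\<^sub>0, min b' b\<^sub>0, b] ! j"
  let ?J = "{0, 1, 2, 3} :: nat set"
  have "(\<integral>\<^sup>+ \<omega>. ennreal (exp ((score n {a'..b'} (observations n {a..b} \<omega>) -
              score n {a\<^sub>0..b\<^sub>0} (observations n {a..b} \<omega>)) / (4 * \<sigma>\<^sup>2))) \<partial>model_space D (gaussian_noise \<sigma>) n) =
      (\<integral>\<^sup>+ \<omega>. (\<Prod>i\<in>{1..n}. g (fst \<omega> i) (snd \<omega> i)) \<partial>model_space D (gaussian_noise \<sigma>) n)"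
  proof (rule nn_integral_cong)
    fix \<omega> :: "(nat \<Rightarrow> real) \<times> (nat \<Rightarrow> real)"
    have "(score n {a'..b'} (observations n {a..b} \<omega>) - score n {a\<^sub>0..b\<^sub>0} (observations n {a..b} \<omega>)) / (4 * \<sigma>\<^sup>2) =
        (\<Sum>i\<in>{1..n}. 2 * \<kappa> * f (fst \<omega> i) * (s (fst \<omega> i) + 2 * snd \<omega> i))"
      by (simp add: score_def observations_def split_beta' f_def s_def \<kappa>_def sum_divide_distrib algebra_simps
          diff_divide_distrib add_divide_distrib flip: sum_subtractf)
    then show "ennreal (exp ((score n {a'..b'} (observations n {a..b} \<omega>) -
        score n {a\<^sub>0..b\<^sub>0} (observations n {a..b} \<omega>)) / (4 * \<sigma>\<^sup>2))) = (\<Prod>i\<in>{1..n}. g (fst \<omega> i) (snd \<omega> i))"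
      by (simp add: exp_sum g_def prod_ennreal)
  qed
  also have "\<dots> \<le> ennreal (exp (real n * (\<Sum>j\<in>?J. ?v j * measure lborel {?a j..?b j}) + (\<Sum>j\<in>?J. \<bar>?v j\<bar>)))"
  proof (rule nn_integral_model_space_prod_le [OF D \<sigma>])
    show "(\<lambda>(x, y). g x y) \<in> borel_measurable (borel \<Otimes>\<^sub>M borel)"
      unfolding g_def by measurable
    show "h \<in> borel_measurable borel"
      unfolding h_def by measurable
    fix x
    have "(\<integral>\<^sup>+ y. g x y \<partial>gaussian_noise \<sigma>) =
        (\<integral>\<^sup>+ y. ennreal (exp (2 * \<kappa> * f x * s x)) * ennreal (exp ((4 * \<kappa> * f x) * y)) \<partial>gaussian_noise \<sigma>)"
      by (intro nn_integral_cong) (simp add: g_def algebra_simps flip: ennreal_mult' exp_add)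
    also have "\<dots> = ennreal (exp (2 * \<kappa> * f x * s x)) * ennreal (exp ((4 * \<kappa> * f x)\<^sup>2 * \<sigma>\<^sup>2 / 2))"
      by (subst nn_integral_cmult) (simp_all add: nn_integral_exp_gaussian_noise [OF \<sigma>])
    also have "(4 * \<kappa> * f x)\<^sup>2 * \<sigma>\<^sup>2 / 2 = \<kappa> * (f x)\<^sup>2"
      using \<sigma> by (simp add: \<kappa>_def field_simps power2_eq_square)
    finally show "(\<integral>\<^sup>+ y. g x y \<partial>gaussian_noise \<sigma>) = ennreal (h x)"
      by (simp add: h_def exp_add ennreal_mult')
  next
    fix j assume "j \<in> ?J"
    then show "0 \<le> ?a j \<and> ?b j \<le> 1"
      using assms by auto
  next
    fix x :: real
    have "exp (3 * \<kappa>) \<le> exp (4 * \<kappa>)"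
      using \<kappa> by simp
    then have "exp (3 * \<kappa>) \<le> exp (- \<kappa>) + C"
      unfolding C_def by (simp add: add_increasing)
    moreover have "x \<in> {a\<^sub>0..b\<^sub>0} \<Longrightarrow> x \<in> {a..b}"
      using sub by blast
    ultimately show "0 \<le> h x \<and> h x \<le> 1 + (\<Sum>j\<in>?J. ?v j * indicator {?a j..?b j} x)"
      using C by (cases "x \<in> {a'..b'}"; cases "x \<in> {a\<^sub>0..b\<^sub>0}"; cases "x \<in> {a..b}")
        (auto simp: h_def f_def s_def q_def indicator_def)
  qed simp
  also have "(\<Sum>j\<in>?J. ?v j * measure lborel {?a j..?b j}) =
      C * (measure lborel {a..b} - measure lborel {a\<^sub>0..b\<^sub>0}) - q * measure lborel (sym_diff {a'..b'} {a\<^sub>0..b\<^sub>0})"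
    unfolding measure_interval_sym_diff by (simp add: algebra_simps del: measure_lborel_Icc)
  also have "(\<Sum>j\<in>?J. \<bar>?v j\<bar>) \<le> 4 + 2 * C"
    using q C by simp
  finally show ?thesis
    by (simp add: C_def q_def \<kappa>_def)
qed

text \<open>
  All pairs of endpoints \<open>j / n\<close>, \<open>k / n\<close> with \<open>j, k \<le> n\<close> are enumerated by \<open>p = j (n + 1) + k\<close>, which
  ranges over the numbers below \<open>(n + 1)\<^sup>2\<close>; for \<open>j > k\<close> the segment is empty.
\<close>

definition grid_segment :: "nat \<Rightarrow> nat \<Rightarrow> real set" where
  "grid_segment n p = {real (p div Suc n) / real n..real (p mod Suc n) / real n}"

text \<open>
  Ties are broken by the smallest index, which makes the selection a measurable function of the data.
\<close>

definition best_index :: "nat \<Rightarrow> (nat \<Rightarrow> real \<times> real) \<Rightarrow> nat" where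
  "best_index n d = (LEAST p. p < (Suc n)\<^sup>2 \<and>
     (\<forall>q\<in>{..<(Suc n)\<^sup>2}. score n (grid_segment n q) d \<le> score n (grid_segment n p) d))"

definition least_squares_estimator :: "nat \<Rightarrow> (nat \<Rightarrow> real \<times> real) \<Rightarrow> real set" where
  "least_squares_estimator n d = grid_segment n (best_index n d)"

lemma grid_segment_borel [measurable, simp]: "grid_segment n p \<in> sets borel"
  by (simp add: grid_segment_def)

lemma best_index:
  shows "best_index n d < (Suc n)\<^sup>2"
    and "q < (Suc n)\<^sup>2 \<Longrightarrow> score n (grid_segment n q) d \<le> score n (grid_segment n (best_index n d)) d"
proof -
  let ?s = "\<lambda>p. score n (grid_segment n p) d"
  have ne: "finite (?s ` {..<(Suc n)\<^sup>2})" "?s ` {..<(Suc n)\<^sup>2} \<noteq> {}"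
    by (auto simp: lessThan_empty_iff)
  obtain p where "p < (Suc n)\<^sup>2" "?s p = Max (?s ` {..<(Suc n)\<^sup>2})"
    using Max_in [OF ne] by auto
  then have "\<exists>p. p < (Suc n)\<^sup>2 \<and> (\<forall>q\<in>{..<(Suc n)\<^sup>2}. ?s q \<le> ?s p)"
    using ne(1) by (intro exI [of _ p]) auto
  then have "best_index n d < (Suc n)\<^sup>2 \<and> (\<forall>q\<in>{..<(Suc n)\<^sup>2}. ?s q \<le> ?s (best_index n d))"
    unfolding best_index_def by (rule LeastI_ex)
  then show "best_index n d < (Suc n)\<^sup>2"
    and "q < (Suc n)\<^sup>2 \<Longrightarrow> ?s q \<le> ?s (best_index n d)"
    by auto
qed

lemma grid_segment_endpoints:
  assumes "n \<ge> 1"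
  shows "0 \<le> real (p div Suc n) / real n" "real (p mod Suc n) / real n \<le> 1"
  using assms mod_less_divisor [of "Suc n" p] by (auto simp: less_Suc_eq_le)

lemma grid_segment_subset:
  assumes "n \<ge> 1"
  shows "grid_segment n p \<subseteq> {0..1}"
  using grid_segment_endpoints [OF assms, of p] unfolding grid_segment_def by auto

lemma set_estimator_least_squares_estimator:
  assumes "n \<ge> 1"
  shows "set_estimator n (least_squares_estimator n)"
  unfolding set_estimator_def
proof (intro conjI ballI)
  fix d
  show "least_squares_estimator n d \<subseteq> {0..1}"
    unfolding least_squares_estimator_def using assms by (rule grid_segment_subset)
  show "least_squares_estimator n d \<in> sets lebesgue"
    unfolding least_squares_estimator_def by simp
next
  fix G :: "real set" assume "G \<in> sets borel"
  have score_meas: "score n (grid_segment n p) \<in> borel_measurable (data_space n)" for p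
    by (rule measurable_score) simp
  have le: "Measurable.pred (data_space n) (\<lambda>d. score n (grid_segment n q) d \<le> score n (grid_segment n p) d)" for p q
    unfolding pred_def by (intro borel_measurable_le score_meas)
  have "Measurable.pred (data_space n) (\<lambda>d. p < (Suc n)\<^sup>2 \<and>
      (\<forall>q\<in>{..<(Suc n)\<^sup>2}. score n (grid_segment n q) d \<le> score n (grid_segment n p) d))" for p
    by (intro pred_intros_logic(3) pred_intros_finite(3) le) simp_all
  then have "best_index n \<in> data_space n \<rightarrow>\<^sub>M count_space UNIV"
    unfolding best_index_def by (rule measurable_Least)
  then show "(\<lambda>d. emeasure lebesgue (sym_diff G (least_squares_estimator n d))) \<in> borel_measurable (data_space n)"
    unfolding least_squares_estimator_def
    by (rule measurable_compose [where g = "\<lambda>p. emeasure lebesgue (sym_diff G (grid_segment n p))"]) simp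
qed

text \<open>
  Rounding both endpoints inwards keeps the approximation inside the segment. If the segment is
  shorter than the grid width, the rounded endpoints may cross and the approximation is empty.
\<close>

lemma grid_inner_approximation:
  assumes n: "n \<ge> 1" and ab: "0 \<le> a" "a \<le> b" "b \<le> 1"
  obtains p where "p < (Suc n)\<^sup>2" "grid_segment n p \<subseteq> {a..b}"
    "measure lborel {a..b} - measure lborel (grid_segment n p) \<le> 2 / real n"
proof -
  define j where "j = nat \<lceil>real n * a\<rceil>"
  define k where "k = nat \<lfloor>real n * b\<rfloor>"
  have na: "0 \<le> real n * a" and anb: "real n * a \<le> real n * b" and nb: "real n * b \<le> real n"
    using ab by (auto intro: mult_left_mono mult_left_le)
  have j: "real n * a \<le> real j" "real j \<le> real n * a + 1" "j \<le> n"
    unfolding j_def using na anb nb by linarith+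
  have k: "real k \<le> real n * b" "real n * b \<le> real k + 1" "k \<le> n"
    unfolding k_def using na anb nb by linarith+
  define p where "p = j * Suc n + k"
  have dm: "p div Suc n = j" "p mod Suc n = k"
    unfolding p_def using k(3) by (simp_all del: mult_Suc_right)
  show ?thesis
  proof (rule that)
    have "p \<le> n * Suc n + n"
      unfolding p_def using j(3) k(3) by (intro add_mono mult_le_mono1)
    then show "p < (Suc n)\<^sup>2"
      by (simp add: power2_eq_square)
    show "grid_segment n p \<subseteq> {a..b}"
      unfolding grid_segment_def dm using n j k by (auto simp: field_simps)
    have "a \<le> real j / real n" "real j / real n \<le> a + 1 / real n"
      "real k / real n \<le> b" "b \<le> real k / real n + 1 / real n"
      using n j k by (simp_all add: field_simps)
    moreover have "2 / real n = 1 / real n + 1 / real n"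
      by simp
    ultimately show "measure lborel {a..b} - measure lborel (grid_segment n p) \<le> 2 / real n"
      unfolding grid_segment_def dm using ab by (cases "real j / real n \<le> real k / real n") (simp_all del: divide_le_cancel; linarith)+
  qed
qed

text \<open>
  The loss of the estimator exceeds \<open>2 / n + t\<close> only if some candidate at distance more than \<open>t\<close> from
  the grid approximation \<open>G\<^sub>0\<close> has at least the score of \<open>G\<^sub>0\<close>; the last term is the union bound for
  this event.
\<close>

lemma minimax_risk_le:
  assumes D: "quasi_uniform_design n D" and \<sigma>: "\<sigma> > 0" and n: "n \<ge> 1" and t: "t \<ge> 0"
  defines "q \<equiv> 1 - exp (- 1 / (8 * \<sigma>\<^sup>2))" and "C \<equiv> exp (1 / (2 * \<sigma>\<^sup>2))"
  shows "minimax_risk D (gaussian_noise \<sigma>) n segments \<le>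
    ennreal (2 / real n + t + (real n + 1)\<^sup>2 * exp (4 + 4 * C - real n * q * t))"
proof -
  let ?M = "model_space D (gaussian_noise \<sigma>) n"
  let ?K = "exp (4 + 4 * C - real n * q * t)"
  have q: "q \<ge> 0" using \<sigma> by (simp add: q_def)
  have C: "C > 0" by (simp add: C_def)
  interpret M: prob_space ?M
    using quasi_uniform_designD(1) [OF D] \<sigma> by (rule prob_space_model_space)
  have "risk D (gaussian_noise \<sigma>) n (least_squares_estimator n) G \<le>
      ennreal (2 / real n + t + (real n + 1)\<^sup>2 * ?K)" if "G \<in> segments" for G
  proof -
    from that obtain a b where G: "G = {a..b}" and ab: "0 \<le> a" "a \<le> b" "b \<le> 1"
      by (auto simp: segments_def)
    note obs = measurable_observations [OF quasi_uniform_designD(2) [OF D], of G \<sigma>]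
    from n ab obtain p\<^sub>0 where p\<^sub>0: "p\<^sub>0 < (Suc n)\<^sup>2" "grid_segment n p\<^sub>0 \<subseteq> {a..b}"
      "measure lborel {a..b} - measure lborel (grid_segment n p\<^sub>0) \<le> 2 / real n"
      by (rule grid_inner_approximation)
    define dist where "dist p = measure lborel (sym_diff (grid_segment n p) (grid_segment n p\<^sub>0))" for p
    \<comment> \<open>dominates the indicator of the event that \<open>p\<close> is far from \<open>p\<^sub>0\<close> and is selected\<close>
    define w where "w p \<omega> = (if dist p > t then exp ((score n (grid_segment n p) (observations n G \<omega>) -
        score n (grid_segment n p\<^sub>0) (observations n G \<omega>)) / (4 * \<sigma>\<^sup>2)) else 0)" for p \<omega>
    have lborel_finite: "emeasure lborel A = ennreal (measure lborel A)" "measure lborel A \<le> 1"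
      if "A \<subseteq> {0..1}" "A \<in> sets borel" for A :: "real set"
    proof -
      have le: "emeasure lborel A \<le> ennreal 1"
        using emeasure_mono [OF that(1), of lborel] by simp
      then show "emeasure lborel A = ennreal (measure lborel A)"
        by (intro emeasure_eq_ennreal_measure) (auto simp: top_unique)
      with le show "measure lborel A \<le> 1"
        by simp
    qed
    have [measurable]: "(\<lambda>\<omega>. score n (grid_segment n p) (observations n G \<omega>)) \<in> borel_measurable ?M" for p
      using measurable_compose [OF obs measurable_score] G by simp
    have [measurable]: "w p \<in> borel_measurable ?M" for p
      unfolding w_def by (cases "dist p > t") simp_all
    have w_int: "(\<integral>\<^sup>+ \<omega>. ennreal (w p \<omega>) \<partial>?M) \<le> ennreal ?K" for p
    proof (cases "dist p > t")
      case True
      have "(\<integral>\<^sup>+ \<omega>. ennreal (w p \<omega>) \<partial>?M) \<le>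
          ennreal (exp (real n * (C * (measure lborel {a..b} - measure lborel (grid_segment n p\<^sub>0)) - q * dist p)
            + (4 + 2 * C)))"
        unfolding w_def dist_def C_def q_def G
        using nn_integral_exp_score_diff_le [OF D \<sigma> p\<^sub>0(2) [unfolded grid_segment_def] ab(1,3)
            grid_segment_endpoints [OF n, of p\<^sub>0] grid_segment_endpoints [OF n, of p]] True
        by (simp only: if_True dist_def grid_segment_def [symmetric])
      also have "\<dots> \<le> ennreal ?K"
      proof (intro ennreal_leI exp_le_cancel_iff [THEN iffD2])
        have "real n * (C * (measure lborel {a..b} - measure lborel (grid_segment n p\<^sub>0))) \<le> real n * (C * (2 / real n))"
          using p\<^sub>0(3) C by (intro mult_left_mono) auto
        also have "\<dots> = 2 * C"
          using n by simp
        moreover have "real n * (q * dist p) \<ge> real n * (q * t)"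
          using True q by (intro mult_left_mono) auto
        ultimately show "real n * (C * (measure lborel {a..b} - measure lborel (grid_segment n p\<^sub>0)) - q * dist p)
            + (4 + 2 * C) \<le> 4 + 4 * C - real n * q * t"
          by (simp add: right_diff_distrib mult.assoc)
      qed
      finally show ?thesis .
    qed (simp add: w_def)
    have pointwise: "emeasure lebesgue (sym_diff G (least_squares_estimator n (observations n G \<omega>))) \<le>
        ennreal (2 / real n + t) + (\<Sum>p<(Suc n)\<^sup>2. ennreal (w p \<omega>))" for \<omega>
    proof -
      define p where "p = best_index n (observations n G \<omega>)"
      have p: "p < (Suc n)\<^sup>2"
        unfolding p_def by (rule best_index)
      have "emeasure lebesgue (sym_diff G (grid_segment n p)) = emeasure lborel (sym_diff G (grid_segment n p))"
        by (simp add: G)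
      also have "\<dots> \<le> emeasure lborel ((G - grid_segment n p\<^sub>0) \<union> sym_diff (grid_segment n p) (grid_segment n p\<^sub>0))"
        using p\<^sub>0(2) by (intro emeasure_mono) (auto simp: G)
      also have "\<dots> \<le> emeasure lborel (G - grid_segment n p\<^sub>0) +
          emeasure lborel (sym_diff (grid_segment n p) (grid_segment n p\<^sub>0))"
        by (intro emeasure_subadditive) (auto simp: G)
      also have "emeasure lborel (G - grid_segment n p\<^sub>0) =
          ennreal (measure lborel {a..b} - measure lborel (grid_segment n p\<^sub>0))"
        unfolding G using p\<^sub>0(2) grid_segment_subset [OF n, of p\<^sub>0] ab(2)
        by (subst emeasure_Diff) (auto simp: lborel_finite ennreal_minus)
      also have "\<dots> \<le> ennreal (2 / real n)"
        using p\<^sub>0(3) by (rule ennreal_leI)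
      also have "emeasure lborel (sym_diff (grid_segment n p) (grid_segment n p\<^sub>0)) = ennreal (dist p)"
        unfolding dist_def using grid_segment_subset [OF n] by (intro lborel_finite) auto
      also have "ennreal (dist p) \<le> ennreal t + ennreal (w p \<omega>)"
      proof (cases "dist p > t")
        case True
        have "dist p \<le> 1"
          unfolding dist_def using grid_segment_subset [OF n] by (intro lborel_finite) auto
        also have "1 \<le> w p \<omega>"
          using True best_index(2) [OF p\<^sub>0(1), of "observations n G \<omega>"] by (simp add: w_def p_def)
        finally have "dist p \<le> t + w p \<omega>"
          using t by simp
        then show ?thesis
          using t by (simp add: w_def flip: ennreal_plus)
      next
        case False
        then have "ennreal (dist p) \<le> ennreal t"
          by (simp add: ennreal_leI)
        then show ?thesis
          by (rule add_increasing2 [rotated]) simp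
      qed
      also have "ennreal (w p \<omega>) \<le> (\<Sum>p<(Suc n)\<^sup>2. ennreal (w p \<omega>))"
        using p by (intro member_le_sum) auto
      finally show ?thesis
        using t by (simp add: least_squares_estimator_def p_def ennreal_plus add_mono add.assoc)
    qed
    have "risk D (gaussian_noise \<sigma>) n (least_squares_estimator n) G \<le>
        (\<integral>\<^sup>+ \<omega>. ennreal (2 / real n + t) + (\<Sum>p<(Suc n)\<^sup>2. ennreal (w p \<omega>)) \<partial>?M)"
      unfolding risk_def by (intro nn_integral_mono pointwise)
    also have "\<dots> = ennreal (2 / real n + t) + (\<Sum>p<(Suc n)\<^sup>2. \<integral>\<^sup>+ \<omega>. ennreal (w p \<omega>) \<partial>?M)"
      by (simp add: nn_integral_add nn_integral_sum M.emeasure_space_1)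
    also have "\<dots> \<le> ennreal (2 / real n + t) + (\<Sum>p<(Suc n)\<^sup>2. ennreal ?K)"
      using w_int by (intro add_left_mono sum_mono) auto
    also have "(\<Sum>p<(Suc n)\<^sup>2. ennreal ?K) = ennreal ((real n + 1)\<^sup>2 * ?K)"
      by (subst sum_ennreal) (simp_all add: add.commute)
    also have "ennreal (2 / real n + t) + ennreal ((real n + 1)\<^sup>2 * ?K) =
        ennreal (2 / real n + t + (real n + 1)\<^sup>2 * ?K)"
      using t by (subst ennreal_plus) auto
    finally show ?thesis .
  qed
  then have "(SUP G\<in>segments. risk D (gaussian_noise \<sigma>) n (least_squares_estimator n) G) \<le>
      ennreal (2 / real n + t + (real n + 1)\<^sup>2 * ?K)"
    by (rule SUP_least)
  moreover have "minimax_risk D (gaussian_noise \<sigma>) n segments \<le>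
      (SUP G\<in>segments. risk D (gaussian_noise \<sigma>) n (least_squares_estimator n) G)"
    unfolding minimax_risk_def using set_estimator_least_squares_estimator [OF n] by (intro INF_lower) simp
  ultimately show ?thesis by (rule order_trans [rotated])
qed

section \<open>Changing the unknown set and the lower bound\<close>

definition model_likelihood_ratio ::
    "nat \<Rightarrow> real \<Rightarrow> real set \<Rightarrow> real set \<Rightarrow> (nat \<Rightarrow> real) \<times> (nat \<Rightarrow> real) \<Rightarrow> real" where
  "model_likelihood_ratio n \<sigma> G H \<omega> =
     (\<Prod>i\<in>{1..n}. likelihood_ratio \<sigma> (indicator G (fst \<omega> i) - indicator H (fst \<omega> i)) (snd \<omega> i))"

lemma model_likelihood_ratio_nonneg: "0 \<le> model_likelihood_ratio n \<sigma> G H \<omega>"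
  by (simp add: model_likelihood_ratio_def likelihood_ratio_def prod_nonneg)

lemma measurable_model_likelihood_ratio:
  assumes "sets D = sets (Pi\<^sub>M {1..n} (\<lambda>_. borel))" and [measurable]: "G \<in> sets borel" "H \<in> sets borel"
  shows "model_likelihood_ratio n \<sigma> G H \<in> borel_measurable (model_space D (gaussian_noise \<sigma>) n)"
  unfolding measurable_cong_sets [OF sets_model_space [OF assms(1)] refl] model_likelihood_ratio_def
    likelihood_ratio_def by measurable

text \<open>
  For a fixed design, changing the unknown set from \<open>H\<close> to \<open>G\<close> translates the responses by
  \<open>1\<^sub>G(X\<^sub>i) - 1\<^sub>H(X\<^sub>i)\<close>.
\<close>

lemma nn_integral_change_of_set:
  assumes D: "sets D = sets (Pi\<^sub>M {1..n} (\<lambda>_. borel))" and \<sigma>: "\<sigma> > 0"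
    and G: "G \<in> sets borel" and H: "H \<in> sets borel"
    and \<phi>: "\<phi> \<in> borel_measurable (data_space n)"
  shows "(\<integral>\<^sup>+ \<omega>. \<phi> (observations n G \<omega>) \<partial>model_space D (gaussian_noise \<sigma>) n) =
    (\<integral>\<^sup>+ \<omega>. ennreal (model_likelihood_ratio n \<sigma> G H \<omega>) * \<phi> (observations n H \<omega>)
       \<partial>model_space D (gaussian_noise \<sigma>) n)"
proof -
  let ?N = "Pi\<^sub>M {1..n} (\<lambda>_. gaussian_noise \<sigma>)"
  let ?M = "model_space D (gaussian_noise \<sigma>) n"
  have \<phi>_obs: "(\<lambda>\<omega>. \<phi> (observations n A \<omega>)) \<in> borel_measurable ?M" if "A \<in> sets borel" for A
    using measurable_compose [OF measurable_observations [OF D that] \<phi>] .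
  have inner: "(\<integral>\<^sup>+ \<xi>. \<phi> (observations n G (x, \<xi>)) \<partial>?N) =
      (\<integral>\<^sup>+ \<xi>. ennreal (model_likelihood_ratio n \<sigma> G H (x, \<xi>)) * \<phi> (observations n H (x, \<xi>)) \<partial>?N)" for x
  proof -
    let ?m = "\<lambda>i. indicator G (x i) - indicator H (x i) :: real"
    have meas: "(\<lambda>\<xi>. \<phi> (observations n H (x, \<xi>))) \<in> borel_measurable (Pi\<^sub>M {1..n} (\<lambda>_. borel))"
    proof (rule measurable_compose [OF _ \<phi>])
      show "(\<lambda>\<xi>. observations n H (x, \<xi>)) \<in> Pi\<^sub>M {1..n} (\<lambda>_. borel) \<rightarrow>\<^sub>M data_space n"
        unfolding observations_def data_space_def split_beta' fst_conv snd_conv by measurable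
    qed
    have "observations n H (x, \<lambda>i\<in>{1..n}. ?m i + \<xi> i) = observations n G (x, \<xi>)" for \<xi>
      by (auto simp: observations_def)
    then show ?thesis
      using nn_integral_PiM_likelihood_ratio [OF \<sigma> _ meas, of ?m]
      by (simp add: model_likelihood_ratio_def prod_ennreal likelihood_ratio_def)
  qed
  have "(\<lambda>\<omega>. ennreal (model_likelihood_ratio n \<sigma> G H \<omega>) * \<phi> (observations n H \<omega>)) \<in> borel_measurable ?M"
    using measurable_model_likelihood_ratio [OF D G H] \<phi>_obs [OF H] by measurable
  then show ?thesis
    using \<phi>_obs [OF G] by (simp only: nn_integral_model_space [OF \<sigma>] inner)
qed

lemma nn_integral_likelihood_ratio_square:
  assumes "\<sigma> > 0"
  shows "(\<integral>\<^sup>+ y. ennreal ((likelihood_ratio \<sigma> m y)\<^sup>2) \<partial>gaussian_noise \<sigma>) = ennreal (exp (m\<^sup>2 / \<sigma>\<^sup>2))"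
proof -
  have "(\<integral>\<^sup>+ y. ennreal ((likelihood_ratio \<sigma> m y)\<^sup>2) \<partial>gaussian_noise \<sigma>) =
      (\<integral>\<^sup>+ y. ennreal (exp (- m\<^sup>2 / \<sigma>\<^sup>2)) * ennreal (exp ((2 * m / \<sigma>\<^sup>2) * y)) \<partial>gaussian_noise \<sigma>)"
    using assms
    by (intro nn_integral_cong)
       (simp add: likelihood_ratio_def field_simps flip: ennreal_mult' exp_add exp_of_nat_mult exp_double)
  also have "\<dots> = ennreal (exp (- m\<^sup>2 / \<sigma>\<^sup>2)) * ennreal (exp ((2 * m / \<sigma>\<^sup>2)\<^sup>2 * \<sigma>\<^sup>2 / 2))"
    by (subst nn_integral_cmult) (simp, simp only: nn_integral_exp_gaussian_noise [OF assms])
  also have "\<dots> = ennreal (exp (m\<^sup>2 / \<sigma>\<^sup>2))"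
    using assms by (simp add: power2_eq_square field_simps flip: ennreal_mult' exp_add)
  finally show ?thesis .
qed

text \<open>
  For a fixed design the second moment is \<open>exp (N / \<sigma>\<^sup>2)\<close> with \<open>N\<close> the number of design points where
  the two sets differ. The reference set is the segment \<open>{0..0}\<close>, itself a member of the class; it has
  measure zero, so it affects only the additive constant in the exponent.
\<close>

lemma nn_integral_model_likelihood_ratio_square_le:
  fixes a b :: real
  assumes D: "quasi_uniform_design n D" and \<sigma>: "\<sigma> > 0" and ab: "0 < a" "a \<le> b" "b \<le> 1"
  shows "(\<integral>\<^sup>+ \<omega>. ennreal ((model_likelihood_ratio n \<sigma> {a..b} {0..0} \<omega>)\<^sup>2) \<partial>model_space D (gaussian_noise \<sigma>) n) \<le>
    ennreal (exp ((exp (1 / \<sigma>\<^sup>2) - 1) * (real n * (b - a) + 2)))"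
proof -
  define K where "K = exp (1 / \<sigma>\<^sup>2) - 1"
  have K: "K \<ge> 0"
    by (simp add: K_def)
  define m where "m x = (indicator {a..b} x - indicator {0..0} x :: real)" for x :: real
  have [measurable]: "m \<in> borel_measurable borel"
    unfolding m_def by measurable
  let ?a = "\<lambda>j. [a, 0] ! j"
  let ?b = "\<lambda>j. [b, 0] ! j"
  let ?J = "{0, 1} :: nat set"
  have "(\<integral>\<^sup>+ \<omega>. ennreal ((model_likelihood_ratio n \<sigma> {a..b} {0..0} \<omega>)\<^sup>2) \<partial>model_space D (gaussian_noise \<sigma>) n) =
      (\<integral>\<^sup>+ \<omega>. (\<Prod>i\<in>{1..n}. ennreal ((likelihood_ratio \<sigma> (m (fst \<omega> i)) (snd \<omega> i))\<^sup>2))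
         \<partial>model_space D (gaussian_noise \<sigma>) n)"
    by (simp add: model_likelihood_ratio_def m_def prod_ennreal prod_power_distrib)
  also have "\<dots> \<le> ennreal (exp (real n * (\<Sum>j\<in>?J. K * measure lborel {?a j..?b j}) + (\<Sum>j\<in>?J. \<bar>K\<bar>)))"
  proof (rule nn_integral_model_space_prod_le [OF D \<sigma>])
    show "(\<lambda>(x, y). ennreal ((likelihood_ratio \<sigma> (m x) y)\<^sup>2)) \<in> borel_measurable (borel \<Otimes>\<^sub>M borel)"
      unfolding likelihood_ratio_def by measurable
    show "(\<integral>\<^sup>+ y. ennreal ((likelihood_ratio \<sigma> (m x) y)\<^sup>2) \<partial>gaussian_noise \<sigma>) = ennreal (exp ((m x)\<^sup>2 / \<sigma>\<^sup>2))" for x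
      using \<sigma> by (rule nn_integral_likelihood_ratio_square)
    show "(\<lambda>x. exp ((m x)\<^sup>2 / \<sigma>\<^sup>2)) \<in> borel_measurable borel"
      by measurable
    show "0 \<le> ?a j \<and> ?b j \<le> 1" if "j \<in> ?J" for j
      using that ab by auto
    show "0 \<le> exp ((m x)\<^sup>2 / \<sigma>\<^sup>2) \<and> exp ((m x)\<^sup>2 / \<sigma>\<^sup>2) \<le> 1 + (\<Sum>j\<in>?J. K * indicator {?a j..?b j} x)" for x
      using ab K by (auto simp: m_def indicator_def K_def)
  qed simp
  also have "real n * (\<Sum>j\<in>?J. K * measure lborel {?a j..?b j}) + (\<Sum>j\<in>?J. \<bar>K\<bar>) = K * (real n * (b - a) + 2)"
    using ab K by (simp add: algebra_simps)
  finally show ?thesis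
    by (simp add: K_def)
qed

text \<open>
  Let \<open>r\<close> be the maximal risk of an estimator, \<open>A\<^sub>k\<close> the measure of its part in \<open>G\<^sub>k\<close> and \<open>F\<^sub>k\<close> its
  loss at \<open>G\<^sub>k\<close>. From \<open>\<delta> \<le> F\<^sub>k + A\<^sub>k\<close>, \<open>A\<^sub>k \<le> \<delta>\<close> and \<open>L\<^sub>k \<le> L\<^sub>k\<^sup>2 / (4 B) + B\<close> one gets
  \<open>\<delta> L\<^sub>k \<le> L\<^sub>k F\<^sub>k + \<delta> L\<^sub>k\<^sup>2 / (4 B) + B A\<^sub>k\<close>. Under the reference law the expectations of the first
  three of these four terms are \<open>\<delta>\<close>, at most \<open>r\<close> and at most \<open>\<delta> / 4\<close>, while \<open>\<Sum>k. A\<^sub>k\<close> is at most the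
  measure of the estimator, whose expectation is the risk at \<open>{0}\<close>. Summing over \<open>k\<close> yields
  \<open>M \<delta> \<le> M r + M \<delta> / 4 + B r\<close>, and \<open>B \<le> M\<close> gives \<open>3 \<delta> / 8 \<le> r\<close>.
\<close>

lemma minimax_risk_ge:
  assumes D: "quasi_uniform_design n D" and \<sigma>: "\<sigma> > 0" and \<delta>: "\<delta> > 0" and M: "(real M + 1) * \<delta> \<le> 1"
    and M_large: "exp ((exp (1 / \<sigma>\<^sup>2) - 1) * (real n * \<delta> + 2)) \<le> real M"
  shows "ennreal (3 / 8 * \<delta>) \<le> minimax_risk D (gaussian_noise \<sigma>) n segments"
  unfolding minimax_risk_def
proof (rule INF_greatest)
  fix Ghat assume "Ghat \<in> {Ghat. set_estimator n Ghat}"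
  then have est: "\<And>d. d \<in> space (data_space n) \<Longrightarrow> Ghat d \<subseteq> {0..1} \<and> Ghat d \<in> sets lebesgue"
    and loss_meas: "\<And>G. G \<in> sets borel \<Longrightarrow>
      (\<lambda>d. emeasure lebesgue (sym_diff G (Ghat d))) \<in> borel_measurable (data_space n)"
    by (auto simp: set_estimator_def)
  note D_sets = quasi_uniform_designD(2) [OF D]
  let ?M = "model_space D (gaussian_noise \<sigma>) n"
  interpret prob_space ?M
    using quasi_uniform_designD(1) [OF D] \<sigma> by (rule prob_space_model_space)
  define r where "r = (SUP G\<in>segments. risk D (gaussian_noise \<sigma>) n Ghat G)"
  define B where "B = exp ((exp (1 / \<sigma>\<^sup>2) - 1) * (real n * \<delta> + 2))"
  have B: "B > 0" by (simp add: B_def)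
  define G where "G k = {real k * \<delta>..(real k + 1) * \<delta>}" for k
  define loss where "loss A \<omega> = emeasure lebesgue (sym_diff A (Ghat (observations n {0..0} \<omega>)))" for A \<omega>
  define L where "L k \<omega> = model_likelihood_ratio n \<sigma> (G k) {0..0} \<omega>" for k \<omega>
  have L_nonneg: "L k \<omega> \<ge> 0" for k \<omega>
    unfolding L_def by (rule model_likelihood_ratio_nonneg)
  have G_borel: "G k \<in> sets borel" for k
    by (simp add: G_def)
  have G_seg: "0 < real k * \<delta>" "real k * \<delta> \<le> (real k + 1) * \<delta>" "(real k + 1) * \<delta> \<le> 1" if "k \<in> {1..M}" for k
  proof -
    have "(real k + 1) * \<delta> \<le> (real M + 1) * \<delta>"
      using that \<delta> by (intro mult_right_mono) auto
    with M show "(real k + 1) * \<delta> \<le> 1" by simp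
  qed (use that \<delta> in auto)
  have loss_M [measurable]: "loss A \<in> borel_measurable ?M" if "A \<in> sets borel" for A
    unfolding loss_def using measurable_compose [OF measurable_observations [OF D_sets] loss_meas [OF that]] by simp
  have L_M [measurable]: "L k \<in> borel_measurable ?M" for k
    unfolding L_def by (intro measurable_model_likelihood_ratio D_sets G_borel) simp
  have L_int: "(\<integral>\<^sup>+ \<omega>. ennreal (L k \<omega>) \<partial>?M) = 1" for k
    using nn_integral_change_of_set [OF D_sets \<sigma> G_borel [of k], of "{0..0}" "\<lambda>_. 1"]
    by (simp add: L_def emeasure_space_1)
  have risk_eq: "risk D (gaussian_noise \<sigma>) n Ghat (G k) = (\<integral>\<^sup>+ \<omega>. ennreal (L k \<omega>) * loss (G k) \<omega> \<partial>?M)" for k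
    unfolding risk_def L_def loss_def
    by (rule nn_integral_change_of_set [OF D_sets \<sigma> G_borel _ loss_meas [OF G_borel]]) simp
  have risk_G_le: "(\<integral>\<^sup>+ \<omega>. ennreal (L k \<omega>) * loss (G k) \<omega> \<partial>?M) \<le> r" if "k \<in> {1..M}" for k
    unfolding risk_eq [symmetric] r_def
    by (intro SUP_upper) (use G_seg [OF that] in \<open>auto simp: segments_def G_def\<close>)
  have risk_0_le: "(\<integral>\<^sup>+ \<omega>. loss {0..0} \<omega> \<partial>?M) \<le> r"
  proof -
    have "{0..0} \<in> segments"
      unfolding segments_def by (intro CollectI exI [of _ 0]) simp
    then show ?thesis
      unfolding r_def loss_def risk_def [symmetric] by (rule SUP_upper)
  qed
  have L_square_le: "(\<integral>\<^sup>+ \<omega>. ennreal ((L k \<omega>)\<^sup>2) \<partial>?M) \<le> ennreal B" if "k \<in> {1..M}" for k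
    using nn_integral_model_likelihood_ratio_square_le [OF D \<sigma> G_seg [OF that]]
    by (simp add: L_def B_def G_def algebra_simps)
  have pointwise: "(\<Sum>k\<in>{1..M}. ennreal \<delta> * ennreal (L k \<omega>)) \<le>
      (\<Sum>k\<in>{1..M}. ennreal (L k \<omega>) * loss (G k) \<omega> + ennreal (\<delta> / (4 * B)) * ennreal ((L k \<omega>)\<^sup>2)) +
        ennreal B * loss {0..0} \<omega>" if \<omega>: "\<omega> \<in> space ?M" for \<omega>
  proof -
    define E where "E = Ghat (observations n {0..0} \<omega>)"
    have E: "E \<in> sets lebesgue"
      using est measurable_space [OF measurable_observations [OF D_sets] \<omega>] by (simp add: E_def)
    \<comment> \<open>half-open, so that the pieces are disjoint although neighbouring \<open>G k\<close> share an endpoint\<close>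
    define I where "I k = {real k * \<delta><..(real k + 1) * \<delta>}" for k
    have "ennreal \<delta> * ennreal (L k \<omega>) \<le> ennreal (L k \<omega>) * loss (G k) \<omega> +
        ennreal (\<delta> / (4 * B)) * ennreal ((L k \<omega>)\<^sup>2) + ennreal B * emeasure lebesgue (E \<inter> I k)" for k
    proof -
      have I_le: "emeasure lebesgue (E \<inter> I k) \<le> ennreal \<delta>"
      proof -
        have "emeasure lebesgue (E \<inter> I k) \<le> emeasure lebesgue (I k)"
          using E by (intro emeasure_mono) (auto simp: I_def)
        also have "\<dots> = ennreal \<delta>"
          using \<delta> by (simp add: I_def algebra_simps)
        finally show ?thesis .
      qed
      obtain \<alpha> where \<alpha>: "emeasure lebesgue (E \<inter> I k) = ennreal \<alpha>" "0 \<le> \<alpha>" "\<alpha> \<le> \<delta>"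
      proof (cases "emeasure lebesgue (E \<inter> I k)" rule: ennreal_cases)
        case (real \<alpha>)
        with I_le \<delta> show ?thesis by (intro that) simp_all
      next
        case top
        with I_le show ?thesis by (simp add: top_unique)
      qed
      have "ennreal \<delta> = emeasure lebesgue (I k)"
        using \<delta> by (simp add: I_def algebra_simps)
      also have "\<dots> \<le> emeasure lebesgue (sym_diff (G k) E \<union> (E \<inter> I k))"
        using E by (intro emeasure_mono sets.Un sets.Diff sets.Int) (auto simp: I_def G_def)
      also have "\<dots> \<le> loss (G k) \<omega> + ennreal \<alpha>"
        unfolding loss_def E_def [symmetric] \<alpha>(1) [symmetric]
        using E by (intro emeasure_subadditive sets.Un sets.Diff sets.Int) (auto simp: I_def G_def)
      finally have "ennreal \<delta> * ennreal (L k \<omega>) \<le> (loss (G k) \<omega> + ennreal \<alpha>) * ennreal (L k \<omega>)"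
        by (rule mult_right_mono) simp
      also have "\<dots> = ennreal (L k \<omega>) * loss (G k) \<omega> + ennreal (L k \<omega> * \<alpha>)"
        using L_nonneg \<alpha>(2) by (simp add: algebra_simps ennreal_mult)
      also have "ennreal (L k \<omega> * \<alpha>) \<le> ennreal (\<delta> / (4 * B) * (L k \<omega>)\<^sup>2 + B * \<alpha>)"
      proof (rule ennreal_leI)
        \<comment> \<open>equivalent to \<open>(L k \<omega> - 2 B)\<^sup>2 \<ge> 0\<close>\<close>
        have "L k \<omega> \<le> (L k \<omega>)\<^sup>2 / (4 * B) + B"
          using B zero_le_power2 [of "L k \<omega> - 2 * B"] by (simp add: field_simps power2_eq_square)
        then have "L k \<omega> * \<alpha> \<le> ((L k \<omega>)\<^sup>2 / (4 * B) + B) * \<alpha>"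
          using \<alpha>(2) by (rule mult_right_mono)
        also have "\<dots> \<le> (L k \<omega>)\<^sup>2 / (4 * B) * \<delta> + B * \<alpha>"
          unfolding distrib_right using \<alpha> B by (intro add_right_mono mult_left_mono) auto
        finally show "L k \<omega> * \<alpha> \<le> \<delta> / (4 * B) * (L k \<omega>)\<^sup>2 + B * \<alpha>"
          by (simp add: mult.commute)
      qed
      also have "ennreal (\<delta> / (4 * B) * (L k \<omega>)\<^sup>2 + B * \<alpha>) =
          ennreal (\<delta> / (4 * B)) * ennreal ((L k \<omega>)\<^sup>2) + ennreal B * ennreal \<alpha>"
        using \<alpha>(2) B \<delta> by (subst (1 2) ennreal_mult [symmetric], simp_all del: times_divide_eq_left)
      finally show ?thesis
        by (simp only: \<alpha>(1) add.assoc add_left_mono)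
    qed
    then have "(\<Sum>k\<in>{1..M}. ennreal \<delta> * ennreal (L k \<omega>)) \<le>
        (\<Sum>k\<in>{1..M}. ennreal (L k \<omega>) * loss (G k) \<omega> + ennreal (\<delta> / (4 * B)) * ennreal ((L k \<omega>)\<^sup>2)) +
        ennreal B * (\<Sum>k\<in>{1..M}. emeasure lebesgue (E \<inter> I k))"
      unfolding sum_distrib_left sum.distrib [symmetric] by (intro sum_mono)
    also have "(\<Sum>k\<in>{1..M}. emeasure lebesgue (E \<inter> I k)) = emeasure lebesgue (\<Union>k\<in>{1..M}. E \<inter> I k)"
    proof (rule sum_emeasure)
      have "I j \<inter> I k = {}" if "j < k" for j k
      proof -
        have "(real j + 1) * \<delta> \<le> real k * \<delta>"
          using that \<delta> by (intro mult_right_mono) auto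
        then show ?thesis
          by (auto simp: I_def)
      qed
      then show "disjoint_family_on (\<lambda>k. E \<inter> I k) {1..M}"
        unfolding disjoint_family_on_def by (metis Int_assoc Int_commute Int_empty_right nat_neq_iff)
    qed (use E in \<open>auto simp: I_def\<close>)
    also have "\<dots> \<le> loss {0..0} \<omega>"
      unfolding loss_def E_def [symmetric]
      using E \<delta> by (intro emeasure_mono sets.Un sets.Diff) (auto simp: I_def mult_less_0_iff)
    finally show ?thesis
      by (simp add: mult_left_mono add_left_mono)
  qed
  have "ennreal (real M * \<delta>) = (\<integral>\<^sup>+ \<omega>. (\<Sum>k\<in>{1..M}. ennreal \<delta> * ennreal (L k \<omega>)) \<partial>?M)"
    using \<delta> by (simp add: nn_integral_sum nn_integral_cmult L_int ennreal_mult ennreal_of_nat_eq_real_of_nat)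
  also have "\<dots> \<le> (\<integral>\<^sup>+ \<omega>. (\<Sum>k\<in>{1..M}. ennreal (L k \<omega>) * loss (G k) \<omega> + ennreal (\<delta> / (4 * B)) * ennreal ((L k \<omega>)\<^sup>2)) +
        ennreal B * loss {0..0} \<omega> \<partial>?M)"
    by (intro nn_integral_mono pointwise)
  also have "\<dots> = (\<Sum>k\<in>{1..M}. (\<integral>\<^sup>+ \<omega>. ennreal (L k \<omega>) * loss (G k) \<omega> \<partial>?M) +
        ennreal (\<delta> / (4 * B)) * (\<integral>\<^sup>+ \<omega>. ennreal ((L k \<omega>)\<^sup>2) \<partial>?M)) + ennreal B * (\<integral>\<^sup>+ \<omega>. loss {0..0} \<omega> \<partial>?M)"
    using loss_M [OF G_borel] loss_M [of "{0..0}"]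
    by (simp add: nn_integral_add nn_integral_sum nn_integral_cmult del: sum.distrib)
  also have "\<dots> \<le> (\<Sum>k\<in>{1..M}. r + ennreal (\<delta> / (4 * B)) * ennreal B) + ennreal B * r"
    by (intro add_mono sum_mono mult_left_mono risk_G_le L_square_le risk_0_le) auto
  also have "\<dots> \<le> (\<Sum>k\<in>{1..M}. r + ennreal (\<delta> / 4)) + ennreal (real M) * r"
    using B \<delta> M_large
    by (intro add_mono mult_right_mono sum_mono) (auto simp: B_def ennreal_leI simp flip: ennreal_mult)
  finally have main: "ennreal (real M * \<delta>) \<le> (\<Sum>k\<in>{1..M}. r + ennreal (\<delta> / 4)) + ennreal (real M) * r" .
  have M_pos: "real M > 0"
    using M_large by (rule order.strict_trans2 [OF exp_gt_zero])
  show "ennreal (3 / 8 * \<delta>) \<le> (SUP G\<in>segments. risk D (gaussian_noise \<sigma>) n Ghat G)"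
  proof (cases r)
    case (real \<rho>)
    have "(\<Sum>k\<in>{1..M}. r + ennreal (\<delta> / 4)) + ennreal (real M) * r = ennreal (real M * (2 * \<rho> + \<delta> / 4))"
      using real \<delta> by (simp add: ennreal_of_nat_eq_real_of_nat algebra_simps flip: ennreal_plus ennreal_mult)
    with main have "real M * \<delta> \<le> real M * (2 * \<rho> + \<delta> / 4)"
      using real \<delta> by (simp add: ennreal_le_iff)
    with M_pos have "\<delta> \<le> 2 * \<rho> + \<delta> / 4"
      by simp
    then have "3 / 8 * \<delta> \<le> \<rho>"
      by simp
    then show ?thesis
      using real by (simp add: r_def [symmetric] ennreal_leI)
  qed (simp add: r_def [symmetric])
qed

section \<open>The minimax rate\<close>

text \<open>
  With \<open>K = exp (1 / \<sigma>\<^sup>2) - 1\<close>, the choice \<open>\<delta> = ln n / (2 K n)\<close> makes the second moment bound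
  \<open>exp (K (n \<delta> + 2))\<close> of order \<open>sqrt n\<close>, whereas about \<open>1 / \<delta>\<close>, that is, a multiple of
  \<open>n / ln n\<close>, adjacent segments of length \<open>\<delta>\<close> fit into the unit interval.
\<close>

lemma minimax_risk_eventually_ge:
  assumes \<sigma>: "\<sigma> > 0"
  obtains c where "c > 0" "\<forall>\<^sub>F n in sequentially. \<forall>D. quasi_uniform_design n D \<longrightarrow>
    ennreal (c * (ln (real n) / real n)) \<le> minimax_risk D (gaussian_noise \<sigma>) n segments"
proof -
  define K where "K = exp (1 / \<sigma>\<^sup>2) - 1"
  define c where "c = 1 / (2 * K)"
  have K: "K > 0" and c: "c > 0"
    using \<sigma> by (auto simp: K_def c_def)
  define A where "A = exp (2 * K)"
  have A: "A > 0" by (simp add: A_def)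
  have "\<forall>\<^sub>F n in sequentially. A * sqrt (real n) \<le> real n / (c * ln (real n)) - 2"
    using A c by real_asymp
  then have "\<forall>\<^sub>F n in sequentially. \<forall>D. quasi_uniform_design n D \<longrightarrow>
      ennreal ((3 / 8 * c) * (ln (real n) / real n)) \<le> minimax_risk D (gaussian_noise \<sigma>) n segments"
    using eventually_ge_at_top [of 2]
  proof eventually_elim
    case (elim n)
    define \<delta> where "\<delta> = c * (ln (real n) / real n)"
    \<comment> \<open>one segment fewer than fit, because the segment starting at \<open>0\<close> meets the reference set\<close>
    define M where "M = nat (\<lfloor>1 / \<delta>\<rfloor> - 1)"
    have \<delta>: "\<delta> > 0"
      using c elim(2) by (simp add: \<delta>_def)
    have "A * sqrt (real n) \<le> 1 / \<delta> - 2"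
      using elim(1) by (simp add: \<delta>_def)
    moreover have "1 \<le> A * sqrt (real n)"
      using elim(2) K by (simp add: A_def mult_ge1_I)
    ultimately have M: "real M + 1 \<le> 1 / \<delta>" "A * sqrt (real n) \<le> real M"
      unfolding M_def by linarith+
    have "exp (K * (real n * \<delta> + 2)) = A * exp (ln (real n) / 2)"
      using elim(2) K by (simp add: \<delta>_def c_def A_def field_simps flip: exp_add)
    also have "exp (ln (real n) / 2) = sqrt (real n)"
      using elim(2) by (simp add: ln_sqrt [symmetric])
    finally have "exp (K * (real n * \<delta> + 2)) \<le> real M"
      using M(2) by simp
    then have "ennreal (3 / 8 * \<delta>) \<le> minimax_risk D (gaussian_noise \<sigma>) n segments"
      if "quasi_uniform_design n D" for D
      using that \<sigma> \<delta> M(1) unfolding K_def by (intro minimax_risk_ge [where M = M]) (simp_all add: field_simps)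
    then show ?case
      by (simp add: \<delta>_def mult.assoc)
  qed
  with c show ?thesis
    by (intro that [of "3 / 8 * c"]) auto
qed

text \<open>
  At \<open>t = 3 ln n / (q n)\<close> each candidate contributes a probability of order \<open>1 / n\<^sup>3\<close>, so the union bound
  over \<open>(n + 1)\<^sup>2\<close> candidates is of order \<open>1 / n\<close>.
\<close>

lemma minimax_risk_eventually_le:
  assumes \<sigma>: "\<sigma> > 0"
  obtains C where "C > 0" "\<forall>\<^sub>F n in sequentially. \<forall>D. quasi_uniform_design n D \<longrightarrow>
    minimax_risk D (gaussian_noise \<sigma>) n segments \<le> ennreal (C * (ln (real n) / real n))"
proof -
  define q where "q = 1 - exp (- 1 / (8 * \<sigma>\<^sup>2))"
  define A where "A = exp (4 + 4 * exp (1 / (2 * \<sigma>\<^sup>2)))"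
  have q: "q > 0" and A: "A > 0"
    using \<sigma> by (auto simp: q_def A_def)
  have "\<forall>\<^sub>F n in sequentially. 2 / real n + (real n + 1)\<^sup>2 * (A / real n ^ 3) \<le> ln (real n) / real n"
    using A by real_asymp
  then have "\<forall>\<^sub>F n in sequentially. \<forall>D. quasi_uniform_design n D \<longrightarrow>
      minimax_risk D (gaussian_noise \<sigma>) n segments \<le> ennreal ((3 / q + 1) * (ln (real n) / real n))"
    using eventually_ge_at_top [of 1]
  proof eventually_elim
    case (elim n)
    let ?t = "3 * ln (real n) / (q * real n)"
    have "exp (4 + 4 * exp (1 / (2 * \<sigma>\<^sup>2)) - real n * q * ?t) = A * exp (- (3 * ln (real n)))"
      using elim(2) q by (simp add: A_def flip: exp_add)
    also have "\<dots> = A / real n ^ 3"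
      using elim(2) by (simp add: exp_minus exp_of_nat_mult [of 3, simplified] field_simps)
    finally have eq: "exp (4 + 4 * exp (1 / (2 * \<sigma>\<^sup>2)) - real n * q * ?t) = A / real n ^ 3" .
    have t: "?t \<ge> 0"
      using elim(2) q by simp
    have "minimax_risk D (gaussian_noise \<sigma>) n segments \<le> ennreal (2 / real n + ?t + (real n + 1)\<^sup>2 * (A / real n ^ 3))"
      if "quasi_uniform_design n D" for D
      using minimax_risk_le [OF that \<sigma> elim(2) t] eq unfolding q_def by simp
    moreover have "2 / real n + ?t + (real n + 1)\<^sup>2 * (A / real n ^ 3) \<le> (3 / q + 1) * (ln (real n) / real n)"
    proof -
      have "(3 / q + 1) * (ln (real n) / real n) = ?t + ln (real n) / real n"
        using q elim(2) by (simp add: field_simps)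
      with elim(1) show ?thesis by linarith
    qed
    ultimately show ?case
      by (meson ennreal_leI order_trans)
  qed
  with q show ?thesis
    by (intro that [of "3 / q + 1"]) (auto intro: add_pos_pos)
qed

theorem theorem7:
  fixes \<sigma> :: real
  assumes "\<sigma> > 0"
  shows "\<exists>c>0. \<exists>C>0. \<forall>D\<in>{regular_design, random_design}. \<forall>\<^sub>F n in sequentially.
    ennreal (c * (ln (real n) / real n)) \<le> minimax_risk (D n) (gaussian_noise \<sigma>) n segments \<and>
    minimax_risk (D n) (gaussian_noise \<sigma>) n segments \<le> ennreal (C * (ln (real n) / real n))"
proof -
  obtain c where c: "c > 0" "\<forall>\<^sub>F n in sequentially. \<forall>D. quasi_uniform_design n D \<longrightarrow>
      ennreal (c * (ln (real n) / real n)) \<le> minimax_risk D (gaussian_noise \<sigma>) n segments"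
    using assms by (rule minimax_risk_eventually_ge)
  obtain C where C: "C > 0" "\<forall>\<^sub>F n in sequentially. \<forall>D. quasi_uniform_design n D \<longrightarrow>
      minimax_risk D (gaussian_noise \<sigma>) n segments \<le> ennreal (C * (ln (real n) / real n))"
    using assms by (rule minimax_risk_eventually_le)
  have "\<forall>\<^sub>F n in sequentially.
      ennreal (c * (ln (real n) / real n)) \<le> minimax_risk (D n) (gaussian_noise \<sigma>) n segments \<and>
      minimax_risk (D n) (gaussian_noise \<sigma>) n segments \<le> ennreal (C * (ln (real n) / real n))"
    if "D \<in> {regular_design, random_design}" for D
    using c(2) C(2) eventually_ge_at_top [of 1]
  proof eventually_elim
    case (elim n)
    have "quasi_uniform_design n (D n)"
      using that elim(3) quasi_uniform_regular_design quasi_uniform_random_design by auto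
    with elim show ?case by blast
  qed
  with c(1) C(1) show ?thesis by blast
qed

end
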